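(* Let $\zeta$ be an aperiodic primitive constant-shape substitution with expansion matrix $L$ and support $F_{1}$. Consider another fundamental domain $G_1\subset \mathbb{Z}^{d}$ of $L(\mathbb{Z}^d)$ in $\mathbb{Z}^d$, with $0\in G_1$, and such that the associated sequences $(F_{n})_{n>0}$ and $(G_{n})_{n>0}$, defined by $F_{n+1}=L(F_n)+F_1$ and $G_{n+1}=L(G_n)+G_1$, are Følner. Then there exists a computable aperiodic primitive constant-shape substitution $\tilde{\zeta}$ with expansion matrix $L$ and support $G_{1}$ such that $(X_{\zeta},S,\mathbb{Z}^{d})$ and $(X_{\tilde{\zeta}},S,\mathbb{Z}^{d})$ are topologically conjugate.
   Context: Fix $d\ge 1$; $\|\cdot\|$ is the Euclidean norm on $\mathbb{R}^d$. An integer $d\times d$ matrix $L$ is an expansion matrix if there is $\lambda>1$ with $\|Lx\|>\lambda\|x\|$ for all $x\in\mathbb{R}^d\setminus\{0\}$. A fundamental domain of $L(\mathbb{Z}^d)$ in $\mathbb{Z}^d$ is a set containing exactly one representative of each class of $\mathbb{Z}^d/L(\mathbb{Z}^d)$; supports of substitutions are always taken to contain $0$. A sequence of finite sets $(E_n)$ in $\mathbb{Z}^d$ is Følner if $|E_n\Delta(m+E_n)|/|E_n|\to0$ for every $m\in\mathbb{Z}^d$. For a finite alphabet $\mathcal A$, $\mathcal A^{\mathbb{Z}^d}$ has the product topology and $\mathbb{Z}^d$ acts by $S^{n}(x)_{k}=x_{n+k}$. A subshift is a closed $S$-invariant subset. A pattern is an element of $\mathcal A^P$ with $P\subset\mathbb{Z}^d$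 finite; it occurs in $x$ (or in a larger pattern) if it equals, up to translation of its support, a restriction of it. Two subshifts are topologically conjugate if there is a homeomorphism between them commuting with all $S^n$. A constant-shape substitution with expansion matrix $L$ and support $F_1$ (a fundamental domain of $L(\mathbb{Z}^d)$ in $\mathbb{Z}^d$) is a map $\zeta:\mathcal A\to\mathcal A^{F_1}$, $\mathcal A$ a finite alphabet. With $F_{n+1}=L(F_n)+F_1$, the iterates $\zeta^n:\mathcal A\to\mathcal A^{F_n}$ are defined by $\zeta^1=\zeta$ and $\zeta^{n+1}(a)_{L(j)+f}=\zeta(\zeta^n(a)_j)_f$ for $j\in F_n$, $f\in F_1$. $X_\zeta\subseteq \mathcal A^{\mathbb{Z}^d}$ is the set of all $x$ such that every pattern occurring in $x$ occurs in $\zeta^n(a)$ for some $n>0$, $a\in\mathcal A$. $\zeta$ is primitive if there is $n>0$ such that for all $a,b\in\mathcal A$, $b$ occurs in $\zeta^n(a)$. $\zeta$ is aperiodic if $S^px=x$ with $x\in X_\zeta$, $p\in\mathbb{Z}^d$, implies $p=0$. "Computable" means that $\tilde\zeta$ (its finite alphabet and its map) can be produced by an algorithm from $\zeta$ and $G_1$. The alphabet of $\tilde\zeta$ may differ from that of $\zeta$. *)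

theory Defs
  imports "HOL-Analysis.Analysis" "HOL-Library.Nat_Bijection"
begin

section \<open>Expansion matrices, fundamental domains and Folner sequences\<close>

definition expansion_matrix :: "int^'d^'d \<Rightarrow> bool" where
  "expansion_matrix L \<longleftrightarrow>
     (\<exists>c>1. \<forall>x :: real^'d. x \<noteq> 0 \<longrightarrow> norm (map_matrix real_of_int L *v x) > c * norm x)"

definition fundamental_domain :: "int^'d^'d \<Rightarrow> (int^'d) set \<Rightarrow> bool" where
  "fundamental_domain L F \<longleftrightarrow> (\<forall>k. \<exists>!f. f \<in> F \<and> k - f \<in> range ((*v) L))"

definition folner :: "(nat \<Rightarrow> (int^'d) set) \<Rightarrow> bool" where
  "folner E \<longleftrightarrow> (\<forall>n. finite (E n)) \<and>
     (\<forall>m. (\<lambda>n. real (card (sym_diff (E n) ((+) m ` E n))) / real (card (E n))) \<longlonglongrightarrow> 0)"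

text \<open>The sequence of supports starts at index 0 with \<open>{0}\<close>, so that index 1 gives \<open>F\<close> itself
  (lemma \<open>supp_1\<close>).\<close>

primrec supp :: "int^'d^'d \<Rightarrow> (int^'d) set \<Rightarrow> nat \<Rightarrow> (int^'d) set" where
  "supp L F 0 = {0}"
| "supp L F (Suc n) = {L *v j + f | j f. j \<in> supp L F n \<and> f \<in> F}"

lemma supp_1: "supp L F (Suc 0) = F"
  by (auto simp: matrix_vector_mult_0_right)


section \<open>Configurations and patterns\<close>

definition shift :: "int^'d \<Rightarrow> (int^'d \<Rightarrow> 'a) \<Rightarrow> (int^'d \<Rightarrow> 'a)" where
  "shift n x = (\<lambda>k. x (n + k))"

text \<open>A pattern is a partial map with finite domain (its support). A configuration \<open>x\<close> is
  viewed as the everywhere defined partial map \<open>Some \<circ> x\<close>.\<close>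

definition occurs :: "(int^'d \<rightharpoonup> 'a) \<Rightarrow> (int^'d \<rightharpoonup> 'a) \<Rightarrow> bool" where
  "occurs u w \<longleftrightarrow> (\<exists>t. u \<subseteq>\<^sub>m (\<lambda>k. w (k + t)))"

definition config_topology :: "'a set \<Rightarrow> (int^'d \<Rightarrow> 'a) topology" where
  "config_topology A = product_topology (\<lambda>_. discrete_topology A) UNIV"

text \<open>Conjugacy of the subshifts \<open>X\<close> over the alphabet \<open>A\<close> and \<open>Y\<close> over the alphabet \<open>B\<close>.\<close>

definition conjugate ::
    "'a set \<Rightarrow> (int^'d \<Rightarrow> 'a) set \<Rightarrow> 'b set \<Rightarrow> (int^'d \<Rightarrow> 'b) set \<Rightarrow> bool" where
  "conjugate A X B Y \<longleftrightarrow>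
     (\<exists>h. homeomorphic_map (subtopology (config_topology A) X) (subtopology (config_topology B) Y) h
        \<and> (\<forall>n. \<forall>x\<in>X. h (shift n x) = shift n (h x)))"


section \<open>Constant-shape substitutions\<close>

text \<open>Only the values \<open>\<zeta> a f\<close> with \<open>a \<in> A\<close> and \<open>f \<in> F\<close> are meaningful.\<close>

definition substitution ::
    "'a set \<Rightarrow> int^'d^'d \<Rightarrow> (int^'d) set \<Rightarrow> ('a \<Rightarrow> int^'d \<Rightarrow> 'a) \<Rightarrow> bool" where
  "substitution A L F \<zeta> \<longleftrightarrow>
     finite A \<and> expansion_matrix L \<and> fundamental_domain L F \<and> 0 \<in> F \<and>
     (\<forall>a\<in>A. \<forall>f\<in>F. \<zeta> a f \<in> A)"

text \<open>The unique \<open>(j, f)\<close> with \<open>f \<in> F\<close> and \<open>k = L j + f\<close>.\<close>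

definition decomp :: "int^'d^'d \<Rightarrow> (int^'d) set \<Rightarrow> int^'d \<Rightarrow> (int^'d) \<times> (int^'d)" where
  "decomp L F k = (THE (j, f). f \<in> F \<and> k = L *v j + f)"

text \<open>The iterates, starting at index 0 with the letter \<open>a\<close> placed at the origin; for the defining
  equations from index 1 on see \<open>iterate_1\<close> and \<open>iterate_Suc\<close>.\<close>

primrec iterate ::
    "int^'d^'d \<Rightarrow> (int^'d) set \<Rightarrow> ('a \<Rightarrow> int^'d \<Rightarrow> 'a) \<Rightarrow> nat \<Rightarrow> 'a \<Rightarrow> (int^'d \<rightharpoonup> 'a)" where
  "iterate L F \<zeta> 0 a = [0 \<mapsto> a]"
| "iterate L F \<zeta> (Suc n) a =
     (\<lambda>k. case decomp L F k of (j, f) \<Rightarrow> map_option (\<lambda>b. \<zeta> b f) (iterate L F \<zeta> n a j))"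

definition subst_shift ::
    "'a set \<Rightarrow> int^'d^'d \<Rightarrow> (int^'d) set \<Rightarrow> ('a \<Rightarrow> int^'d \<Rightarrow> 'a) \<Rightarrow> (int^'d \<Rightarrow> 'a) set" where
  "subst_shift A L F \<zeta> =
     {x. range x \<subseteq> A \<and>
         (\<forall>u. finite (dom u) \<and> occurs u (Some \<circ> x) \<longrightarrow>
              (\<exists>n>0. \<exists>a\<in>A. occurs u (iterate L F \<zeta> n a)))}"

definition primitive ::
    "'a set \<Rightarrow> int^'d^'d \<Rightarrow> (int^'d) set \<Rightarrow> ('a \<Rightarrow> int^'d \<Rightarrow> 'a) \<Rightarrow> bool" where
  "primitive A L F \<zeta> \<longleftrightarrow> (\<exists>n>0. \<forall>a\<in>A. \<forall>b\<in>A. b \<in> ran (iterate L F \<zeta> n a))"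

definition aperiodic ::
    "'a set \<Rightarrow> int^'d^'d \<Rightarrow> (int^'d) set \<Rightarrow> ('a \<Rightarrow> int^'d \<Rightarrow> 'a) \<Rightarrow> bool" where
  "aperiodic A L F \<zeta> \<longleftrightarrow> (\<forall>x\<in>subst_shift A L F \<zeta>. \<forall>p. shift p x = x \<longrightarrow> p = 0)"

lemma expansion_matrix_inj:
  assumes "expansion_matrix L" "L *v i = L *v j"
  shows "i = j"
proof (rule ccontr)
  assume "i \<noteq> j"
  define x :: "real^'a" where "x = (\<chi> c. real_of_int ((i - j) $ c))"
  have "x \<noteq> 0"
    using \<open>i \<noteq> j\<close> by (auto simp: x_def vec_eq_iff)
  moreover have "map_matrix real_of_int L *v x = 0"
  proof -
    have "L *v (i - j) = 0"
      using assms(2) by (simp add: matrix_vector_mult_diff_distrib)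
    then have "(\<Sum>c\<in>UNIV. L $ r $ c * (i - j) $ c) = 0" for r
      by (simp add: matrix_vector_mult_def vec_eq_iff)
    then have "real_of_int (\<Sum>c\<in>UNIV. L $ r $ c * (i - j) $ c) = 0" for r
      by simp
    then show ?thesis
      by (simp add: matrix_vector_mult_def vec_eq_iff x_def)
  qed
  ultimately obtain c :: real where "c > 1" "0 > c * norm x"
    using assms(1) unfolding expansion_matrix_def by (metis norm_zero)
  then show False
    by (simp add: mult_less_0_iff)
qed

lemma decomp_eq:
  assumes "substitution A L F \<zeta>" "f \<in> F"
  shows "decomp L F (L *v j + f) = (j, f)"
  unfolding decomp_def
proof (rule the_equality)
  show "case (j, f) of (i, g) \<Rightarrow> g \<in> F \<and> L *v j + f = L *v i + g"
    using assms(2) by simp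
next
  fix q assume "case q of (i, g) \<Rightarrow> g \<in> F \<and> L *v j + f = L *v i + g"
  then obtain i g where q: "q = (i, g)" "g \<in> F" "L *v j + f = L *v i + g"
    by (cases q) auto
  have "(L *v j + f) - f \<in> range ((*v) L)"
    by simp
  moreover have "(L *v j + f) - g \<in> range ((*v) L)"
    unfolding q(3) by simp
  ultimately have "f = g"
    using assms q(2) unfolding substitution_def fundamental_domain_def by blast
  then have "i = j"
    using q(3) assms(1) expansion_matrix_inj[of L i j] by (simp add: substitution_def)
  then show "q = (j, f)"
    using q(1) \<open>f = g\<close> by simp
qed

lemma decomp_ex:
  assumes "substitution A L F \<zeta>"
  obtains j f where "f \<in> F" "k = L *v j + f"
proof -
  obtain f where "f \<in> F" "k - f \<in> range ((*v) L)"
    using assms unfolding substitution_def fundamental_domain_def by metis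
  then obtain j where "k - f = L *v j"
    by blast
  then have "k = L *v j + f"
    by (simp add: algebra_simps)
  with \<open>f \<in> F\<close> show thesis
    by (rule that)
qed

lemma iterate_Suc:
  assumes "substitution A L F \<zeta>" "f \<in> F"
  shows "iterate L F \<zeta> (Suc n) a (L *v j + f) = map_option (\<lambda>b. \<zeta> b f) (iterate L F \<zeta> n a j)"
  by (simp add: decomp_eq[OF assms])

lemma dom_iterate:
  assumes "substitution A L F \<zeta>"
  shows "dom (iterate L F \<zeta> n a) = supp L F n"
proof (induction n)
  case 0
  then show ?case by (auto simp: dom_def)
next
  case (Suc n)
  have "k \<in> dom (iterate L F \<zeta> (Suc n) a) \<longleftrightarrow> k \<in> supp L F (Suc n)" for k
  proof -
    obtain j f where k: "f \<in> F" "k = L *v j + f"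
      using decomp_ex[OF assms] by blast
    have "k \<in> supp L F (Suc n) \<longleftrightarrow> j \<in> supp L F n"
    proof
      assume "k \<in> supp L F (Suc n)"
      then obtain i g where i: "i \<in> supp L F n" "g \<in> F" "k = L *v i + g"
        by auto
      then have "(j, f) = (i, g)"
        using decomp_eq[OF assms, of f j] decomp_eq[OF assms, of g i] k by metis
      with i show "j \<in> supp L F n" by simp
    qed (use k in auto)
    moreover have "k \<in> dom (iterate L F \<zeta> (Suc n) a) \<longleftrightarrow> j \<in> dom (iterate L F \<zeta> n a)"
      unfolding k(2) domIff iterate_Suc[OF assms k(1)] by simp
    ultimately show ?thesis
      using Suc.IH by blast
  qed
  then show ?case by blast
qed

lemma iterate_1:
  assumes "substitution A L F \<zeta>" "f \<in> F"
  shows "iterate L F \<zeta> (Suc 0) a f = Some (\<zeta> a f)"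
  using iterate_Suc[OF assms, of 0 a 0] by (simp add: matrix_vector_mult_0_right)


section \<open>Computability\<close>

text \<open>The partial recursive functions, as programs with a big-step evaluation relation:
  \<open>evaluates p xs y\<close> says that \<open>p\<close> terminates on the arguments \<open>xs\<close> with value \<open>y\<close>.
  \<open>Pr\<close> recurses on the first argument, \<open>Mn\<close> is unbounded minimisation.\<close>

datatype recf = Z | S | Proj nat | Cn recf "recf list" | Pr recf recf | Mn recf

inductive evaluates :: "recf \<Rightarrow> nat list \<Rightarrow> nat \<Rightarrow> bool" where
  Z: "evaluates Z xs 0"
| S: "evaluates S [x] (Suc x)"
| Proj: "i < length xs \<Longrightarrow> evaluates (Proj i) xs (xs ! i)"
| Cn: "list_all2 (\<lambda>g y. evaluates g xs y) gs ys \<Longrightarrow> evaluates f ys z \<Longrightarrow>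
       evaluates (Cn f gs) xs z"
| Pr_0: "evaluates f xs y \<Longrightarrow> evaluates (Pr f g) (0 # xs) y"
| Pr_Suc: "evaluates (Pr f g) (n # xs) y \<Longrightarrow> evaluates g (n # y # xs) z \<Longrightarrow>
       evaluates (Pr f g) (Suc n # xs) z"
| Mn: "evaluates f (n # xs) 0 \<Longrightarrow> (\<forall>m<n. \<exists>y. y \<noteq> 0 \<and> evaluates f (m # xs) y) \<Longrightarrow>
       evaluates (Mn f) xs n"

inductive_cases evaluates_elims:
  "evaluates Z xs y" "evaluates S xs y" "evaluates (Proj i) xs y" "evaluates (Cn f gs) xs y"
  "evaluates (Pr f g) (0 # xs) y" "evaluates (Pr f g) (Suc n # xs) y" "evaluates (Mn f) xs y"

lemma evaluates_unique: "evaluates p xs y \<Longrightarrow> evaluates p xs y' \<Longrightarrow> y = y'"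
proof (induction p xs y arbitrary: y' rule: evaluates.induct)
  case (Z xs)
  then show ?case by (rule evaluates_elims(1)) simp
next
  case (S x)
  then show ?case by (rule evaluates_elims(2)) simp
next
  case (Proj i xs)
  from Proj.prems show ?case by (rule evaluates_elims(3)) simp
next
  case (Cn xs gs ys f z)
  from Cn.prems obtain ys' where ys':
    "list_all2 (\<lambda>g y. evaluates g xs y) gs ys'" "evaluates f ys' y'"
    by (rule evaluates_elims(4))
  have "ys = ys'"
  proof (rule nth_equalityI)
    have len: "length ys = length gs" "length ys' = length gs"
      using Cn.IH(1) ys'(1) by (auto dest: list_all2_lengthD)
    then show "length ys = length ys'" by simp
    fix i assume i: "i < length ys"
    have "evaluates (gs ! i) xs (ys' ! i)"
      using list_all2_nthD2[OF ys'(1)] i len by simp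
    then show "ys ! i = ys' ! i"
      using list_all2_nthD2[OF Cn.IH(1) i] by blast
  qed
  then show ?case
    using Cn.IH(2) ys'(2) by blast
next
  case (Pr_0 f xs y g)
  from Pr_0.prems have "evaluates f xs y'" by (rule evaluates_elims(5))
  then show ?case by (rule Pr_0.IH)
next
  case (Pr_Suc f g n xs y z)
  from Pr_Suc.prems obtain w where "evaluates (Pr f g) (n # xs) w" "evaluates g (n # w # xs) y'"
    by (rule evaluates_elims(6))
  then show ?case
    using Pr_Suc.IH by blast
next
  case (Mn f n xs)
  from Mn.prems have y': "evaluates f (y' # xs) 0" "\<forall>m<y'. \<exists>y. y \<noteq> 0 \<and> evaluates f (m # xs) y"
    by (rule evaluates_elims(7), simp)+
  consider "n < y'" | "y' < n" | "n = y'" by linarith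
  then show ?case
  proof cases
    case 1
    then obtain w where "w \<noteq> 0" "evaluates f (n # xs) w" using y'(2) by blast
    then show ?thesis using Mn.IH(1) by blast
  next
    case 2
    then show ?thesis using Mn.IH(2) y'(1) by blast
  qed
qed

text \<open>Codes of the finite data. The list \<open>ds\<close> enumerates the coordinates, and \<open>e\<close> numbers the
  letters. A substitution is coded by its alphabet and its finite graph
  \<open>{(a, f, \<zeta> a f) | a \<in> A, f \<in> F}\<close>.\<close>

definition code_vec :: "'d list \<Rightarrow> int^'d \<Rightarrow> nat" where
  "code_vec ds v = list_encode (map (\<lambda>i. int_encode (v $ i)) ds)"

definition code_matrix :: "'d list \<Rightarrow> int^'d^'d \<Rightarrow> nat" where
  "code_matrix ds L = list_encode (map (\<lambda>i. code_vec ds (L $ i)) ds)"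

definition code_domain :: "'d list \<Rightarrow> (int^'d) set \<Rightarrow> nat" where
  "code_domain ds F = set_encode (code_vec ds ` F)"

definition code_subst ::
    "'d list \<Rightarrow> ('a \<Rightarrow> nat) \<Rightarrow> 'a set \<Rightarrow> (int^'d) set \<Rightarrow> ('a \<Rightarrow> int^'d \<Rightarrow> 'a) \<Rightarrow> nat" where
  "code_subst ds e A F \<zeta> =
     prod_encode (set_encode (e ` A),
       set_encode ((\<lambda>(a, f). prod_encode (e a, prod_encode (code_vec ds f, e (\<zeta> a f)))) ` (A \<times> F)))"

end

(* Choose a finite window K containing 0 with G + K contained in L(K) + F; a large ball works, as L is
   expanding. A block w of shape K then determines, for each g in G, the block of shape K found at
   g in zeta(w), and this defines a substitution xi of support G on blocks. Since supp L G n
   contains translates of any finite set, it contains a full piece L^k j + supp L F k for large n,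
   so xi^n of any block sees zeta^k of a letter, hence by primitivity every block of the language.
   Therefore the language on K is the unique minimal nonempty set of blocks closed under xi, xi is
   primitive on it, and reading x through K is a conjugacy. Minimality is a finite check, so
   an unbounded search finds K, the alphabet and xi. *)

theory Submission
  imports Defs
begin

section \<open>Computable functions and decidable predicates\<close>

text \<open>The cells \<open>L j + G\<close> and \<open>L j + F\<close> cut the lattice along
  different boundaries, so an image \<open>\<zeta> a\<close>, carried by \<open>F\<close>, does not
  fill the cell of shape \<open>G\<close> that should replace it. Remembering the letters in a
  window repairs this: every position of \<open>G + K\<close> lies in a cell \<open>L j + F\<close>
  with \<open>j\<close> in \<open>K\<close>, so its letter is already determined.

  The language itself is a limit over all iterates and is never enumerated. Minimality replaces it
  as a finite certificate: the blocks of \<open>B\<close> that occur in iterates of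
  \<open>\<zeta>\<close> form a nonempty closed subset, hence all of \<open>B\<close>, whichever
  certificate is found. So the argument has two halves: every triple (window, alphabet, graph of
  \<open>\<xi>\<close>) that passes the checks yields a recoding with all the required properties,
  and some triple passes. The second half picks a minimal closed set from a finite family and needs
  no information about the language.\<close>

definition computable :: "nat \<Rightarrow> (nat list \<Rightarrow> nat) \<Rightarrow> bool" where
  "computable n f \<longleftrightarrow> (\<exists>p. \<forall>xs. length xs = n \<longrightarrow> evaluates p xs (f xs))"

text \<open>Truth is the value 0 because \<open>Mn\<close> stops at the first zero.\<close>

definition decidable :: "nat \<Rightarrow> (nat list \<Rightarrow> bool) \<Rightarrow> bool" where
  "decidable n P \<longleftrightarrow> computable n (\<lambda>xs. if P xs then 0 else 1)"

lemma computable_cong: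
  assumes "\<And>xs. length xs = n \<Longrightarrow> f xs = g xs"
  shows "computable n f \<longleftrightarrow> computable n g"
  using assms by (simp add: computable_def cong: conj_cong)

lemma decidable_cong:
  assumes "\<And>xs. length xs = n \<Longrightarrow> P xs = Q xs"
  shows "decidable n P \<longleftrightarrow> decidable n Q"
  unfolding decidable_def by (rule computable_cong) (simp add: assms)

lemma computable_nth: "i < n \<Longrightarrow> computable n (\<lambda>xs. xs ! i)"
  unfolding computable_def by (blast intro: evaluates.Proj)

lemma computable_comp:
  assumes f: "computable (length gs) f" and gs: "\<And>g. g \<in> set gs \<Longrightarrow> computable n g"
  shows "computable n (\<lambda>xs. f (map (\<lambda>g. g xs) gs))"
proof -
  obtain p where p: "\<And>ys. length ys = length gs \<Longrightarrow> evaluates p ys (f ys)"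
    using f by (auto simp: computable_def)
  obtain q where q: "\<And>g xs. g \<in> set gs \<Longrightarrow> length xs = n \<Longrightarrow> evaluates (q g) xs (g xs)"
    using gs unfolding computable_def by metis
  have "evaluates (Cn p (map q gs)) xs (f (map (\<lambda>g. g xs) gs))" if "length xs = n" for xs
    by (rule evaluates.Cn[of _ _ "map (\<lambda>g. g xs) gs"])
       (auto simp: list_all2_conv_all_nth intro!: q p that)
  then show ?thesis
    unfolding computable_def by blast
qed

lemma computable_comp1:
  assumes "computable 1 (\<lambda>xs. f (xs ! 0))" "computable n g"
  shows "computable n (\<lambda>xs. f (g xs))"
  using computable_comp[of "[g]" "\<lambda>xs. f (xs ! 0)" n] assms by simp

text \<open>Weakening: a quantified or searched variable is put in front of the argument list, so a
  function of the outer arguments is read off the tail. Together with \<open>computable_hd\<close>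
  it lets the decidability proofs below follow the syntax of a formula.\<close>

lemma computable_tl:
  assumes "computable n f"
  shows "computable (Suc n) (\<lambda>xs. f (tl xs))"
proof -
  let ?gs = "map (\<lambda>i (xs :: nat list). xs ! i) [Suc 0..<Suc n]"
  have "computable (Suc n) (\<lambda>xs. f (map (\<lambda>g. g xs) ?gs))"
    by (rule computable_comp) (auto simp: assms simp del: upt_Suc intro!: computable_nth)
  moreover have "map (\<lambda>g. g xs) ?gs = tl xs" if "length xs = Suc n" for xs :: "nat list"
    using that by (intro nth_equalityI) (auto simp: nth_tl simp del: upt_Suc)
  ultimately show ?thesis
    by (subst computable_cong[where g = "\<lambda>xs. f (map (\<lambda>g. g xs) ?gs)"]) simp_all
qed

lemma computable_hd: "computable (Suc n) hd"
  using computable_nth[of 0 "Suc n"]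
  by (subst computable_cong[where g = "\<lambda>xs. xs ! 0"]) (auto simp: hd_conv_nth length_Suc_conv)

lemma computable_Suc:
  assumes "computable n f"
  shows "computable n (\<lambda>xs. Suc (f xs))"
proof (rule computable_comp1[OF _ assms])
  have "evaluates S xs (Suc (xs ! 0))" if "length xs = 1" for xs
    using that evaluates.S by (cases xs) auto
  then show "computable 1 (\<lambda>xs. Suc (xs ! 0))"
    unfolding computable_def by blast
qed

lemma computable_const: "computable n (\<lambda>_. c)"
proof (induction c)
  case 0
  then show ?case
    unfolding computable_def by (blast intro: evaluates.Z)
qed (rule computable_Suc)

lemma computable_rec_nat:
  assumes f: "computable n f" and g: "computable (Suc (Suc n)) (\<lambda>xs. g (xs ! 0) (xs ! 1) (drop 2 xs))"
    and h: "computable n h"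
  shows "computable n (\<lambda>xs. rec_nat (f xs) (\<lambda>m y. g m y xs) (h xs))"
proof -
  obtain p where p: "\<And>xs. length xs = n \<Longrightarrow> evaluates p xs (f xs)"
    using f by (auto simp: computable_def)
  obtain q where q: "\<And>xs. length xs = Suc (Suc n) \<Longrightarrow> evaluates q xs (g (xs ! 0) (xs ! 1) (drop 2 xs))"
    using g by (auto simp: computable_def)
  have *: "evaluates (Pr p q) (m # xs) (rec_nat (f xs) (\<lambda>m y. g m y xs) m)"
    if "length xs = n" for m xs
  proof (induction m)
    case 0
    then show ?case by (auto intro: evaluates.Pr_0 p that)
  next
    case (Suc m)
    have "evaluates q (m # rec_nat (f xs) (\<lambda>m y. g m y xs) m # xs)
        (g m (rec_nat (f xs) (\<lambda>m y. g m y xs) m) xs)"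
      using q[of "m # rec_nat (f xs) (\<lambda>m y. g m y xs) m # xs"] that by simp
    with Suc show ?case by (auto intro: evaluates.Pr_Suc)
  qed
  have "evaluates (Pr p q) xs (rec_nat (f (tl xs)) (\<lambda>m y. g m y (tl xs)) (hd xs))"
    if "length xs = Suc n" for xs
    using that * by (cases xs) auto
  then have c: "computable (Suc n) (\<lambda>xs. rec_nat (f (tl xs)) (\<lambda>m y. g m y (tl xs)) (hd xs))"
    unfolding computable_def by blast
  \<comment> \<open>\<open>Pr\<close> expects the counter as its first argument, so the value of
    \<open>h\<close> is placed before projections that rebuild the original list.\<close>
  let ?gs = "h # map (\<lambda>i (xs :: nat list). xs ! i) [0..<n]"
  have "computable n (\<lambda>xs. rec_nat (f (tl (map (\<lambda>g. g xs) ?gs)))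
      (\<lambda>m y. g m y (tl (map (\<lambda>g. g xs) ?gs))) (hd (map (\<lambda>g. g xs) ?gs)))"
    by (rule computable_comp) (use c in \<open>auto simp: h intro!: computable_nth\<close>)
  moreover have "map (\<lambda>g. g xs) (map (\<lambda>i (xs :: nat list). xs ! i) [0..<n]) = xs"
    if "length xs = n" for xs :: "nat list"
    using that by (intro nth_equalityI) auto
  ultimately show ?thesis
    by (subst computable_cong) auto
qed

text \<open>Recursion on the truth value: count 0 returns \<open>f\<close>, and the single step
  taken at count 1 returns \<open>g\<close>.\<close>

lemma computable_if:
  assumes P: "decidable n P" and f: "computable n f" and g: "computable n g"
  shows "computable n (\<lambda>xs. if P xs then f xs else g xs)"
proof -
  have "computable (Suc (Suc n)) (\<lambda>xs. g (drop 2 xs))"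
    using computable_tl[OF computable_tl[OF g]] by (simp add: drop_Suc numeral_2_eq_2)
  from computable_rec_nat[OF f this P[unfolded decidable_def]]
  show ?thesis
    by (rule computable_cong[THEN iffD1, rotated]) auto
qed

lemma decidable_const: "decidable n (\<lambda>_. b)"
  unfolding decidable_def by (rule computable_const)

lemma decidable_not: "decidable n P \<Longrightarrow> decidable n (\<lambda>xs. \<not> P xs)"
  using computable_if[OF _ computable_const[of n 1] computable_const[of n 0]]
  unfolding decidable_def by (rule computable_cong[THEN iffD1, rotated]) auto

lemma decidable_conj:
  assumes "decidable n P" "decidable n Q"
  shows "decidable n (\<lambda>xs. P xs \<and> Q xs)"
  using computable_if[OF assms(1) assms(2)[unfolded decidable_def] computable_const[of n 1]]
  unfolding decidable_def by (rule computable_cong[THEN iffD1, rotated]) auto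

lemma decidable_disj:
  assumes "decidable n P" "decidable n Q"
  shows "decidable n (\<lambda>xs. P xs \<or> Q xs)"
  using decidable_not[OF decidable_conj[OF decidable_not decidable_not], OF assms] by simp

lemma decidable_imp:
  assumes "decidable n P" "decidable n Q"
  shows "decidable n (\<lambda>xs. P xs \<longrightarrow> Q xs)"
  using decidable_disj[OF decidable_not, OF assms] by (rule decidable_cong[THEN iffD1, rotated]) blast

section \<open>Arithmetic and comparisons\<close>

lemma computable_add:
  assumes "computable n f" "computable n g"
  shows "computable n (\<lambda>xs. f xs + g xs)"
proof -
  have "computable n (\<lambda>xs. rec_nat (g xs) (\<lambda>m y. Suc y) (f xs))"
    by (rule computable_rec_nat[OF assms(2) _ assms(1)]) (intro computable_Suc computable_nth, simp)
  moreover have "rec_nat b (\<lambda>m y. Suc y) a = a + b" for a b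
    by (induction a) auto
  ultimately show ?thesis by simp
qed

lemma computable_mult:
  assumes "computable n f" "computable n g"
  shows "computable n (\<lambda>xs. f xs * g xs)"
proof -
  have "computable n (\<lambda>xs. rec_nat 0 (\<lambda>m y. y + g xs) (f xs))"
    by (rule computable_rec_nat[OF computable_const _ assms(1)])
       (use computable_tl[OF computable_tl[OF assms(2)]]
        in \<open>intro computable_add computable_nth; simp add: drop_Suc numeral_2_eq_2\<close>)
  moreover have "rec_nat 0 (\<lambda>m y. y + b) a = a * b" for a b :: nat
    by (induction a) auto
  ultimately show ?thesis by simp
qed

lemma computable_power2:
  assumes "computable n f"
  shows "computable n (\<lambda>xs. 2 ^ f xs)"
proof -
  have "computable n (\<lambda>xs. rec_nat 1 (\<lambda>m y. y + y) (f xs))"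
    by (rule computable_rec_nat[OF computable_const _ assms]) (intro computable_add computable_nth; simp)
  moreover have "rec_nat 1 (\<lambda>m y. y + y) a = (2 :: nat) ^ a" for a
    by (induction a) auto
  ultimately show ?thesis by simp
qed

lemma computable_diff:
  assumes "computable n f" "computable n g"
  shows "computable n (\<lambda>xs. f xs - g xs)"
proof -
  have pred: "computable k (\<lambda>xs. h xs - 1)" if "computable k h" for k h
  proof -
    have "computable k (\<lambda>xs. rec_nat 0 (\<lambda>m y. m) (h xs))"
      by (rule computable_rec_nat[OF computable_const _ that]) (intro computable_nth; simp)
    moreover have "rec_nat 0 (\<lambda>m y. m) a = a - 1" for a
      by (cases a) auto
    ultimately show ?thesis by simp
  qed
  have "computable n (\<lambda>xs. rec_nat (f xs) (\<lambda>m y. y - 1) (g xs))"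
    by (rule computable_rec_nat[OF assms(1) _ assms(2)]) (intro pred computable_nth; simp)
  moreover have "rec_nat b (\<lambda>m y. y - 1) a = b - a" for a b :: nat
    by (induction a) auto
  ultimately show ?thesis by simp
qed

lemma decidable_le:
  assumes "computable n f" "computable n g"
  shows "decidable n (\<lambda>xs. f xs \<le> g xs)"
proof -
  have 0: "decidable n (\<lambda>xs. h xs = 0)" if "computable n h" for h
  proof -
    have "computable n (\<lambda>xs. rec_nat 0 (\<lambda>m y. Suc 0) (h xs))"
      by (rule computable_rec_nat[OF computable_const _ that]) (rule computable_const)
    moreover have "rec_nat 0 (\<lambda>m y. Suc 0) a = (if a = 0 then 0 else 1)" for a :: nat
      by (cases a) auto
    ultimately show ?thesis by (simp add: decidable_def)
  qed
  show ?thesis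
    using 0[OF computable_diff[OF assms]] by simp
qed

lemma decidable_less:
  assumes "computable n f" "computable n g"
  shows "decidable n (\<lambda>xs. f xs < g xs)"
  using decidable_not[OF decidable_le[OF assms(2,1)]] by (simp add: not_le)

lemma decidable_eq:
  assumes "computable n f" "computable n g"
  shows "decidable n (\<lambda>xs. f xs = g xs)"
  using decidable_conj[OF decidable_le decidable_le, OF assms assms(2,1)]
  by (rule decidable_cong[THEN iffD1, rotated]) auto

text \<open>Termination is claimed only for inputs that have a witness. The final search is of this
  kind, since numbers that code no substitution need not have one.\<close>

lemma computable_search:
  assumes "decidable (Suc n) (\<lambda>xs. P (hd xs) (tl xs))"
  obtains p where "\<And>xs. length xs = n \<Longrightarrow> \<exists>m. P m xs \<Longrightarrow> evaluates p xs (LEAST m. P m xs)"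
proof -
  obtain q where q: "\<And>xs. length xs = Suc n \<Longrightarrow> evaluates q xs (if P (hd xs) (tl xs) then 0 else 1)"
    using assms by (auto simp: decidable_def computable_def)
  have q': "evaluates q (m # xs) (if P m xs then 0 else 1)" if "length xs = n" for m xs
    using q[of "m # xs"] that by simp
  have "evaluates (Mn q) xs (LEAST m. P m xs)" if "length xs = n" "\<exists>m. P m xs" for xs
  proof (rule evaluates.Mn)
    show "evaluates q ((LEAST m. P m xs) # xs) 0"
      using q'[OF that(1), of "LEAST m. P m xs"] LeastI_ex[OF that(2)] by simp
    show "\<forall>m<LEAST m. P m xs. \<exists>y. y \<noteq> 0 \<and> evaluates q (m # xs) y"
      using q'[OF that(1)] not_less_Least by (metis zero_neq_one)
  qed
  then show thesis by (rule that)
qed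

lemma computable_Least:
  assumes "decidable (Suc n) (\<lambda>xs. P (hd xs) (tl xs))" "\<And>xs. length xs = n \<Longrightarrow> \<exists>m. P m xs"
  shows "computable n (\<lambda>xs. LEAST m. P m xs)"
  using computable_search[OF assms(1)] assms(2) unfolding computable_def by metis

text \<open>A total function with decidable graph is found by minimisation. For
  \<open>triangle\<close>, the decoders and halving this avoids an explicit recursion.\<close>

lemma computable_graph:
  assumes "decidable (Suc n) (\<lambda>xs. hd xs = f (tl xs))"
  shows "computable n f"
  using computable_Least[OF assms] by (rule computable_cong[THEN iffD1, rotated]) (auto intro: Least_equality)

lemma decidable_ex_less:
  assumes P: "decidable (Suc n) (\<lambda>xs. P (hd xs) (tl xs))" and b: "computable n b"
  shows "decidable n (\<lambda>xs. \<exists>y<b xs. P y xs)"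
proof -
  \<comment> \<open>Stopping also at the bound makes the minimisation total; a witness exists
    exactly if it stops earlier.\<close>
  have "decidable (Suc n) (\<lambda>xs. P (hd xs) (tl xs) \<or> b (tl xs) \<le> hd xs)"
    by (intro decidable_disj P decidable_le computable_hd computable_tl b)
  then have "computable n (\<lambda>xs. LEAST m. P m xs \<or> b xs \<le> m)"
    by (rule computable_Least) auto
  then have "decidable n (\<lambda>xs. (LEAST m. P m xs \<or> b xs \<le> m) < b xs)"
    by (rule decidable_less) (rule b)
  moreover have "(LEAST m. P m xs \<or> b xs \<le> m) < b xs \<longleftrightarrow> (\<exists>y<b xs. P y xs)" for xs
  proof
    assume "(LEAST m. P m xs \<or> b xs \<le> m) < b xs"
    moreover have "P (LEAST m. P m xs \<or> b xs \<le> m) xs \<or> b xs \<le> (LEAST m. P m xs \<or> b xs \<le> m)"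
      by (rule LeastI[of _ "b xs"]) simp
    ultimately show "\<exists>y<b xs. P y xs" by auto
  next
    assume "\<exists>y<b xs. P y xs"
    then obtain y where "y < b xs" "P y xs" by blast
    then show "(LEAST m. P m xs \<or> b xs \<le> m) < b xs"
      by (intro le_less_trans[OF Least_le[of _ y]]) auto
  qed
  ultimately show ?thesis by simp
qed

section \<open>Codes of pairs, finite sets and integers\<close>

lemma computable_prod_encode:
  assumes "computable n f" "computable n g"
  shows "computable n (\<lambda>xs. prod_encode (f xs, g xs))"
proof -
  have "computable n (\<lambda>xs. triangle (h xs))" if h: "computable n h" for h
  proof (rule computable_graph)
    have "decidable (Suc n) (\<lambda>xs. 2 * hd xs = h (tl xs) * Suc (h (tl xs)))"
      by (intro decidable_eq computable_mult computable_const computable_hd computable_Suc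
          computable_tl h)
    moreover have "a = triangle b \<longleftrightarrow> 2 * a = b * Suc b" for a b
      by (auto simp: triangle_def)
    ultimately show "decidable (Suc n) (\<lambda>xs. hd xs = triangle (h (tl xs)))"
      by simp
  qed
  then show ?thesis
    unfolding prod_encode_def by (simp add: computable_add assms)
qed

lemma computable_fst_prod_decode:
  assumes "computable n f"
  shows "computable n (\<lambda>xs. fst (prod_decode (f xs)))"
proof (rule computable_graph)
  \<comment> \<open>A component of a pair never exceeds the code of the pair, so the missing one is
    found by a bounded search.\<close>
  have "decidable (Suc n) (\<lambda>xs. \<exists>y<Suc (f (tl xs)). f (tl xs) = prod_encode (hd xs, y))"
    by (intro decidable_ex_less decidable_eq computable_prod_encode computable_tl computable_hd
        computable_Suc assms)
  moreover have "(\<exists>y<Suc c. c = prod_encode (a, y)) \<longleftrightarrow> a = fst (prod_decode c)" for a c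
    by (metis fst_conv le_imp_less_Suc le_prod_encode_2 prod.collapse prod_decode_inverse
        prod_encode_inverse)
  ultimately show "decidable (Suc n) (\<lambda>xs. hd xs = fst (prod_decode (f (tl xs))))"
    by simp
qed

lemma computable_snd_prod_decode:
  assumes "computable n f"
  shows "computable n (\<lambda>xs. snd (prod_decode (f xs)))"
proof (rule computable_graph)
  have "decidable (Suc n) (\<lambda>xs. \<exists>y<Suc (f (tl xs)). f (tl xs) = prod_encode (y, hd xs))"
    by (intro decidable_ex_less decidable_eq computable_prod_encode computable_tl computable_hd
        computable_Suc assms)
  moreover have "(\<exists>y<Suc c. c = prod_encode (y, a)) \<longleftrightarrow> a = snd (prod_decode c)" for a c
    by (metis snd_conv le_imp_less_Suc le_prod_encode_1 prod.collapse prod_decode_inverse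
        prod_encode_inverse)
  ultimately show "decidable (Suc n) (\<lambda>xs. hd xs = snd (prod_decode (f (tl xs))))"
    by simp
qed

lemma in_set_decode_less: "a \<in> set_decode s \<Longrightarrow> a < s"
proof -
  assume "a \<in> set_decode s"
  then have "s div 2 ^ a \<noteq> 0"
    by (metis set_decode_def mem_Collect_eq even_zero)
  then have "2 ^ a \<le> s"
    by (simp add: div_eq_0_iff)
  then show "a < s"
    using less_exp[of a] by linarith
qed

lemma decidable_mem:
  assumes "computable n f" "computable n g"
  shows "decidable n (\<lambda>xs. f xs \<in> set_decode (g xs))"
proof -
  \<comment> \<open>Bit \<open>a\<close> of the code is set exactly if the quotient by
    \<open>2 ^ a\<close> is odd, written without division as \<open>2 * q + 1\<close> with a
    remainder \<open>r\<close>.\<close>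
  have "decidable n (\<lambda>xs. \<exists>q<Suc (g xs). \<exists>r<2 ^ f xs. g xs = (2 * q + 1) * 2 ^ f xs + r)"
    by (intro decidable_ex_less decidable_eq computable_add computable_mult computable_const
        computable_power2 computable_tl computable_hd computable_Suc assms)
  moreover have "(\<exists>q<Suc s. \<exists>r<2 ^ a. s = (2 * q + 1) * 2 ^ a + r) \<longleftrightarrow> a \<in> set_decode s" for a s :: nat
  proof
    assume "a \<in> set_decode s"
    then obtain q where q: "s div 2 ^ a = 2 * q + 1"
      by (auto simp: set_decode_def elim: oddE)
    then have "s = (2 * q + 1) * 2 ^ a + s mod 2 ^ a"
      by (metis div_mult_mod_eq)
    moreover have "q < Suc s"
      using q by (metis Suc_leI div_le_dividend le_imp_less_Suc le_trans less_add_one mult_2 le_add1 add.assoc)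
    ultimately show "\<exists>q<Suc s. \<exists>r<2 ^ a. s = (2 * q + 1) * 2 ^ a + r"
      by (metis mod_less_divisor pos2 zero_less_power)
  next
    assume "\<exists>q<Suc s. \<exists>r<2 ^ a. s = (2 * q + 1) * 2 ^ a + r"
    then obtain q r where "r < 2 ^ a" "s = (2 * q + 1) * 2 ^ a + r" by blast
    then have "s div 2 ^ a = 2 * q + 1"
      by (intro div_nat_eqI) (simp_all add: algebra_simps)
    then show "a \<in> set_decode s"
      by (simp add: set_decode_def)
  qed
  ultimately show ?thesis by simp
qed

lemma decidable_bex:
  assumes P: "decidable (Suc n) (\<lambda>xs. P (hd xs) (tl xs))" and b: "computable n b"
  shows "decidable n (\<lambda>xs. \<exists>y\<in>set_decode (b xs). P y xs)"
proof -
  have "decidable n (\<lambda>xs. \<exists>y<b xs. y \<in> set_decode (b xs) \<and> P y xs)"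
    by (intro decidable_ex_less decidable_conj decidable_mem P b computable_tl computable_hd)
  moreover have "(\<exists>y<b xs. y \<in> set_decode (b xs) \<and> P y xs) \<longleftrightarrow> (\<exists>y\<in>set_decode (b xs). P y xs)" for xs
    using in_set_decode_less by blast
  ultimately show ?thesis by simp
qed

lemma decidable_ball:
  assumes P: "decidable (Suc n) (\<lambda>xs. P (hd xs) (tl xs))" and b: "computable n b"
  shows "decidable n (\<lambda>xs. \<forall>y\<in>set_decode (b xs). P y xs)"
  using decidable_not[OF decidable_bex[OF decidable_not[OF P] b]] by simp

lemma decidable_all_le:
  assumes P: "decidable (Suc n) (\<lambda>xs. P (hd xs) (tl xs))" and b: "computable n b"
  shows "decidable n (\<lambda>xs. \<forall>y\<le>b xs. P y xs)"
  using decidable_not[OF decidable_ex_less[OF decidable_not[OF P] computable_Suc[OF b]]]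
  by (simp add: less_Suc_eq_le)

text \<open>\<open>recf\<close> knows only natural numbers. An integer is carried as a difference of
  two of them, which is stable under sums and products and turns equality into a comparison of
  sums.\<close>

definition int_computable :: "nat \<Rightarrow> (nat list \<Rightarrow> int) \<Rightarrow> bool" where
  "int_computable n f \<longleftrightarrow>
     (\<exists>g h. computable n g \<and> computable n h \<and> (\<forall>xs. f xs = int (g xs) - int (h xs)))"

lemma int_computable_decode:
  assumes "computable n f"
  shows "int_computable n (\<lambda>xs. int_decode (f xs))"
proof -
  have even: "decidable n (\<lambda>xs. even (f xs))"
  proof -
    have "decidable n (\<lambda>xs. \<exists>y<Suc (f xs). f xs = 2 * y)"
      by (intro decidable_ex_less decidable_eq computable_mult computable_tl computable_hd
          computable_Suc computable_const assms)
    moreover have "(\<exists>y<Suc a. a = 2 * y) \<longleftrightarrow> even a" for a :: nat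
      by (auto elim!: evenE)
    ultimately show ?thesis by simp
  qed
  have half: "computable n (\<lambda>xs. f xs div 2)"
  proof (rule computable_graph)
    have "decidable (Suc n) (\<lambda>xs. 2 * hd xs \<le> f (tl xs) \<and> f (tl xs) < 2 * Suc (hd xs))"
      by (intro decidable_conj decidable_le decidable_less computable_mult computable_tl
          computable_hd computable_Suc computable_const assms)
    moreover have "2 * a \<le> b \<and> b < 2 * Suc a \<longleftrightarrow> a = b div 2" for a b :: nat
      by auto
    ultimately show "decidable (Suc n) (\<lambda>xs. hd xs = f (tl xs) div 2)"
      by simp
  qed
  show ?thesis
    unfolding int_computable_def
  proof (intro exI conjI allI)
    show "computable n (\<lambda>xs. if even (f xs) then f xs div 2 else 0)"
      by (intro computable_if even half computable_const)
    \<comment> \<open>An odd code \<open>2 * m + 1\<close> stands for \<open>- m - 1\<close>, hence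
      the successor.\<close>
    show "computable n (\<lambda>xs. if even (f xs) then 0 else Suc (f xs div 2))"
      by (intro computable_if even half computable_const computable_Suc)
  qed (auto simp: int_decode_def sum_decode_def)
qed

lemma int_computable_add:
  assumes "int_computable n f" "int_computable n f'"
  shows "int_computable n (\<lambda>xs. f xs + f' xs)"
proof -
  obtain g h g' h' where *: "computable n g" "computable n h" "computable n g'" "computable n h'"
    "f = (\<lambda>xs. int (g xs) - int (h xs))" "f' = (\<lambda>xs. int (g' xs) - int (h' xs))"
    using assms unfolding int_computable_def by (metis (no_types, opaque_lifting) ext)
  show ?thesis
    unfolding int_computable_def
    by (rule exI[of _ "\<lambda>xs. g xs + g' xs"], rule exI[of _ "\<lambda>xs. h xs + h' xs"])
       (simp add: * computable_add)
qed

lemma int_computable_mult: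
  assumes "int_computable n f" "int_computable n f'"
  shows "int_computable n (\<lambda>xs. f xs * f' xs)"
proof -
  obtain g h g' h' where *: "computable n g" "computable n h" "computable n g'" "computable n h'"
    "f = (\<lambda>xs. int (g xs) - int (h xs))" "f' = (\<lambda>xs. int (g' xs) - int (h' xs))"
    using assms unfolding int_computable_def by (metis (no_types, opaque_lifting) ext)
  show ?thesis
    unfolding int_computable_def
    by (rule exI[of _ "\<lambda>xs. g xs * g' xs + h xs * h' xs"],
        rule exI[of _ "\<lambda>xs. g xs * h' xs + h xs * g' xs"])
       (simp add: * computable_add computable_mult algebra_simps)
qed

lemma int_computable_sum_list:
  assumes "\<And>i. i \<in> set is \<Longrightarrow> int_computable n (f i)"
  shows "int_computable n (\<lambda>xs. \<Sum>i\<leftarrow>is. f i xs)"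
  using assms
proof (induction "is")
  case Nil
  have "int_computable n (\<lambda>_. 0)"
    unfolding int_computable_def by (intro exI[of _ "\<lambda>_. 0"]) (simp add: computable_const)
  then show ?case by simp
qed (simp add: int_computable_add)

lemma decidable_int_eq:
  assumes "int_computable n f" "int_computable n f'"
  shows "decidable n (\<lambda>xs. f xs = f' xs)"
proof -
  obtain g h g' h' where *: "computable n g" "computable n h" "computable n g'" "computable n h'"
    "f = (\<lambda>xs. int (g xs) - int (h xs))" "f' = (\<lambda>xs. int (g' xs) - int (h' xs))"
    using assms unfolding int_computable_def by (metis (no_types, opaque_lifting) ext)
  have "decidable n (\<lambda>xs. g xs + h' xs = g' xs + h xs)"
    by (intro decidable_eq computable_add *)
  moreover have "f xs = f' xs \<longleftrightarrow> g xs + h' xs = g' xs + h xs" for xs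
    by (auto simp: *(5,6))
  ultimately show ?thesis by simp
qed

lemma decidable_all_list:
  assumes "\<And>i. i \<in> set is \<Longrightarrow> decidable n (P i)"
  shows "decidable n (\<lambda>xs. \<forall>i\<in>set is. P i xs)"
  using assms by (induction "is") (auto intro: decidable_const decidable_conj)

section \<open>Iterated substitutions and block recodings\<close>

text \<open>Acts on arbitrary partial patterns and not only on letters, because the recoding
  iterates \<open>\<zeta>\<close> on blocks.\<close>

definition apply_subst ::
    "int^'d^'d \<Rightarrow> (int^'d) set \<Rightarrow> ('a \<Rightarrow> int^'d \<Rightarrow> 'a) \<Rightarrow> (int^'d \<rightharpoonup> 'a) \<Rightarrow> (int^'d \<rightharpoonup> 'a)" where
  "apply_subst L F \<zeta> w = (\<lambda>k. case decomp L F k of (j, f) \<Rightarrow> map_option (\<lambda>b. \<zeta> b f) (w j))"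

lemma iterate_eq_funpow: "iterate L F \<zeta> n a = (apply_subst L F \<zeta> ^^ n) [0 \<mapsto> a]"
  by (induction n) (simp_all add: apply_subst_def)

lemma iterate_add: "iterate L F \<zeta> (n + m) a = (apply_subst L F \<zeta> ^^ n) (iterate L F \<zeta> m a)"
  by (simp add: iterate_eq_funpow funpow_add)

lemma occurs_trans:
  assumes "occurs u v" "occurs v w"
  shows "occurs u w"
proof -
  obtain s t where s: "u \<subseteq>\<^sub>m (\<lambda>k. v (k + s))" and t: "v \<subseteq>\<^sub>m (\<lambda>k. w (k + t))"
    using assms unfolding occurs_def by blast
  have "u \<subseteq>\<^sub>m (\<lambda>k. w (k + (s + t)))"
    unfolding map_le_def
  proof
    fix k assume k: "k \<in> dom u"
    then have "u k = v (k + s)" using s by (auto simp: map_le_def)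
    moreover from this have "v (k + s) = w (k + s + t)"
      using k t by (auto simp: map_le_def dom_def)
    ultimately show "u k = w (k + (s + t))" by (simp add: add.assoc)
  qed
  then show ?thesis unfolding occurs_def by blast
qed

lemma occurs_map_le: "u \<subseteq>\<^sub>m v \<Longrightarrow> occurs u v"
  unfolding occurs_def by (rule exI[of _ 0]) simp

text \<open>Division with remainder by \<open>L\<close>, repeated \<open>n\<close> times; the
  remainders collect to an element of \<open>supp L F n\<close>.\<close>

lemma supp_decompE:
  assumes "fundamental_domain L F"
  obtains j f where "f \<in> supp L F n" "t = ((*v) L ^^ n) j + f"
proof -
  have "\<exists>j f. f \<in> supp L F n \<and> t = ((*v) L ^^ n) j + f"
  proof (induction n arbitrary: t)
    case 0
    then show ?case by simp
  next
    case (Suc n)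
    obtain f where f: "f \<in> F" "t - f \<in> range ((*v) L)"
      using assms unfolding fundamental_domain_def by metis
    then obtain j where j: "t - f = L *v j" by blast
    obtain j' f' where *: "f' \<in> supp L F n" "j = ((*v) L ^^ n) j' + f'"
      using Suc by blast
    have "t = ((*v) L ^^ Suc n) j' + (L *v f' + f)"
      using j * by (simp add: matrix_vector_right_distrib algebra_simps)
    moreover have "L *v f' + f \<in> supp L F (Suc n)"
      using *(1) f(1) by auto
    ultimately show ?case by blast
  qed
  with that show thesis by blast
qed

lemma zero_in_supp: "0 \<in> F \<Longrightarrow> 0 \<in> supp L F n"
  by (induction n) (auto intro!: exI[of _ 0] simp: matrix_vector_mult_0_right)

text \<open>Each translation by an element of \<open>D\<close> moves few points out of \<open>E n\<close>, so for large \<open>n\<close> some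
  point of \<open>E n\<close> is moved out by none of them.\<close>

lemma folner_translate:
  assumes fol: "folner E" and ne: "\<And>n. E n \<noteq> {}" and D: "finite D"
  shows "\<forall>\<^sub>F n in sequentially. \<exists>t. (+) t ` D \<subseteq> E n"
proof (cases "D = {}")
  case False
  have fin: "finite (E n)" for n
    using fol by (simp add: folner_def)
  have card: "real (card (E n)) > 0" for n
    using fin ne by (simp add: card_gt_0_iff)
  let ?r = "\<lambda>m n. real (card (sym_diff (E n) ((+) m ` E n))) / real (card (E n))"
  \<comment> \<open>The point \<open>t + m\<close> lies in \<open>E n\<close> exactly if
    \<open>t\<close> lies in the translate of \<open>E n\<close> by \<open>- m\<close>, so the ratio
    is taken at \<open>- m\<close>.\<close>
  have "(\<lambda>n. \<Sum>m\<in>D. ?r (- m) n) \<longlonglongrightarrow> (\<Sum>m\<in>D. 0)"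
    by (rule tendsto_sum) (use fol in \<open>unfold folner_def, blast\<close>)
  then have "\<forall>\<^sub>F n in sequentially. (\<Sum>m\<in>D. ?r (- m) n) < 1"
    by (auto simp: order_tendsto_iff)
  then show ?thesis
  proof (rule eventually_mono)
    fix n assume "(\<Sum>m\<in>D. ?r (- m) n) < 1"
    then have lt: "(\<Sum>m\<in>D. card (sym_diff (E n) ((+) (- m) ` E n))) < card (E n)"
      using card[of n] by (simp add: sum_divide_distrib[symmetric] flip: of_nat_sum)
    have "card (\<Union>m\<in>D. E n - (+) (- m) ` E n) \<le> (\<Sum>m\<in>D. card (E n - (+) (- m) ` E n))"
      using D by (rule card_UN_le)
    also have "\<dots> \<le> (\<Sum>m\<in>D. card (sym_diff (E n) ((+) (- m) ` E n)))"
      by (intro sum_mono card_mono) (auto simp: fin)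
    finally have "card (\<Union>m\<in>D. E n - (+) (- m) ` E n) < card (E n)"
      using lt by linarith
    moreover have "finite (\<Union>m\<in>D. E n - (+) (- m) ` E n)"
      using D fin by auto
    ultimately obtain t where t: "t \<in> E n" "t \<notin> (\<Union>m\<in>D. E n - (+) (- m) ` E n)"
      by (metis card_mono not_less subsetI)
    have "t + m \<in> E n" if "m \<in> D" for m
      using t that by (auto simp: algebra_simps)
    then show "\<exists>t. (+) t ` D \<subseteq> E n" by blast
  qed
qed auto

text \<open>The invariant relating \<open>\<xi>\<close> to \<open>\<zeta>\<close>: a pattern of
  block symbols describes a pattern of letters through overlapping windows. The pattern
  \<open>w\<close> may extend beyond what \<open>v\<close> describes.\<close>

definition overlays ::
    "(int^'d) set \<Rightarrow> ('b \<Rightarrow> int^'d \<Rightarrow> 'a) \<Rightarrow> (int^'d \<rightharpoonup> 'b) \<Rightarrow> (int^'d \<rightharpoonup> 'a) \<Rightarrow> bool" where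
  "overlays K \<pi> v w \<longleftrightarrow> (\<forall>m b. v m = Some b \<longrightarrow> (\<forall>k\<in>K. w (m + k) = Some (\<pi> b k)))"

context
  fixes A L F and \<zeta> :: "'a \<Rightarrow> int^'d \<Rightarrow> 'a"
  assumes sub: "substitution A L F \<zeta>"
begin

lemma apply_subst_eq: "f \<in> F \<Longrightarrow> apply_subst L F \<zeta> w (L *v j + f) = map_option (\<lambda>b. \<zeta> b f) (w j)"
  by (simp add: apply_subst_def decomp_eq[OF sub])

text \<open>Expansion by \<open>L\<close> turns the offset \<open>t\<close> into
  \<open>L *v t\<close> and leaves the remainder in \<open>F\<close> unchanged.\<close>

lemma apply_subst_map_le:
  assumes "u \<subseteq>\<^sub>m (\<lambda>k. w (k + t))"
  shows "apply_subst L F \<zeta> u \<subseteq>\<^sub>m (\<lambda>k. apply_subst L F \<zeta> w (k + L *v t))"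
  unfolding map_le_def
proof
  fix k assume k: "k \<in> dom (apply_subst L F \<zeta> u)"
  obtain j f where jf: "f \<in> F" "k = L *v j + f"
    using decomp_ex[OF sub] by blast
  have kt: "k + L *v t = L *v (j + t) + f"
    by (simp add: jf(2) matrix_vector_right_distrib algebra_simps)
  moreover have "j \<in> dom u"
    using k unfolding jf(2) by (auto simp: apply_subst_eq jf(1))
  ultimately show "apply_subst L F \<zeta> u k = apply_subst L F \<zeta> w (k + L *v t)"
    using assms unfolding kt apply_subst_eq[OF jf(1)] unfolding jf(2) apply_subst_eq[OF jf(1)]
    by (simp add: map_le_def)
qed

lemma funpow_apply_subst_map_le:
  assumes "u \<subseteq>\<^sub>m (\<lambda>k. w (k + t))"
  shows "(apply_subst L F \<zeta> ^^ n) u \<subseteq>\<^sub>m (\<lambda>k. (apply_subst L F \<zeta> ^^ n) w (k + ((*v) L ^^ n) t))"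
  by (induction n) (simp_all add: assms apply_subst_map_le)

lemma occurs_funpow_apply_subst:
  "occurs u w \<Longrightarrow> occurs ((apply_subst L F \<zeta> ^^ n) u) ((apply_subst L F \<zeta> ^^ n) w)"
  unfolding occurs_def using funpow_apply_subst_map_le by blast

lemma iterate_map_le:
  assumes "w j = Some a"
  shows "iterate L F \<zeta> n a \<subseteq>\<^sub>m (\<lambda>k. (apply_subst L F \<zeta> ^^ n) w (k + ((*v) L ^^ n) j))"
  unfolding iterate_eq_funpow
  by (rule funpow_apply_subst_map_le) (simp add: assms map_le_def)

lemma occurs_iterate: "a \<in> ran w \<Longrightarrow> occurs (iterate L F \<zeta> n a) ((apply_subst L F \<zeta> ^^ n) w)"
  unfolding ran_def occurs_def using iterate_map_le by blast

lemma ran_funpow_apply_subst: "ran w \<subseteq> A \<Longrightarrow> ran ((apply_subst L F \<zeta> ^^ n) w) \<subseteq> A"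
proof (induction n)
  case (Suc n)
  show ?case
  proof
    fix b assume "b \<in> ran ((apply_subst L F \<zeta> ^^ Suc n) w)"
    then obtain k where k: "apply_subst L F \<zeta> ((apply_subst L F \<zeta> ^^ n) w) k = Some b"
      by (auto simp: ran_def)
    obtain j f where jf: "f \<in> F" "k = L *v j + f"
      using decomp_ex[OF sub] by blast
    obtain c where "(apply_subst L F \<zeta> ^^ n) w j = Some c" "b = \<zeta> c f"
      using k by (auto simp: jf apply_subst_eq)
    with Suc jf(1) show "b \<in> A"
      using sub unfolding substitution_def ran_def by blast
  qed
qed simp

lemma ran_iterate: "a \<in> A \<Longrightarrow> ran (iterate L F \<zeta> n a) \<subseteq> A"
  unfolding iterate_eq_funpow by (rule ran_funpow_apply_subst) simp

text \<open>As \<open>0 \<in> F\<close>, the corner \<open>L^n j\<close> of a cell inherits its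
  letter from position \<open>j\<close>. Thus a letter seen at the corner certifies that the whole
  cell is the iterate of a letter.\<close>

lemma dom_funpow_apply_subst:
  "(apply_subst L F \<zeta> ^^ n) w (((*v) L ^^ n) j) \<noteq> None \<Longrightarrow> w j \<noteq> None"
proof (induction n)
  case (Suc n)
  have "0 \<in> F" using sub by (simp add: substitution_def)
  then have "apply_subst L F \<zeta> v (L *v i) = map_option (\<lambda>b. \<zeta> b 0) (v i)" for v i
    using apply_subst_eq[of 0 v i] by simp
  with Suc show ?case by simp
qed simp


text \<open>With \<open>n0\<close> from primitivity, \<open>u\<close> occurs in iterate
  \<open>m + n0\<close> of every letter. For larger \<open>n\<close> this is applied to some letter
  of iterate \<open>n - (m + n0)\<close>, which has one because it is defined at the origin.\<close>

lemma occurs_iterate_eventually: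
  assumes prim: "primitive A L F \<zeta>" and a: "a \<in> A" and u: "occurs u (iterate L F \<zeta> m a)"
  shows "\<forall>\<^sub>F n in sequentially. \<forall>b\<in>A. occurs u (iterate L F \<zeta> n b)"
proof -
  obtain n0 where n0: "\<And>a b. a \<in> A \<Longrightarrow> b \<in> A \<Longrightarrow> b \<in> ran (iterate L F \<zeta> n0 a)"
    using prim by (auto simp: primitive_def)
  have *: "occurs u (iterate L F \<zeta> (m + n0) b)" if "b \<in> A" for b
    unfolding iterate_add
    using u occurs_iterate[OF n0[OF that a]] by (rule occurs_trans)
  have "occurs u (iterate L F \<zeta> n b)" if "b \<in> A" "n \<ge> m + n0" for n b
  proof -
    have "0 \<in> dom (iterate L F \<zeta> (n - (m + n0)) b)"
      unfolding dom_iterate[OF sub] using sub by (intro zero_in_supp) (simp add: substitution_def)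
    then obtain c where c: "c \<in> ran (iterate L F \<zeta> (n - (m + n0)) b)"
      by (auto simp: ran_def)
    then have "occurs u (iterate L F \<zeta> (m + n0) c)"
      using ran_iterate that(1) * by blast
    moreover have "occurs (iterate L F \<zeta> (m + n0) c) (iterate L F \<zeta> n b)"
      using occurs_iterate[OF c, of "m + n0"] that(2) by (simp flip: iterate_add)
    ultimately show ?thesis by (rule occurs_trans)
  qed
  then show ?thesis
    by (auto simp: eventually_sequentially)
qed

end

text \<open>A letter \<open>b\<close> of the new alphabet is an abstract name for the block
  \<open>\<pi> b\<close> of shape \<open>K\<close>; the search will use numbers as names. The
  assumption \<open>minimal\<close> is the finite substitute for \<open>B\<close> being the
  language, and \<open>nonempty\<close> excludes \<open>B = {}\<close> over a nonempty
  \<open>A\<close>, for which \<open>minimal\<close> would hold vacuously.\<close>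

locale block_recoding =
  fixes A :: "'a set" and L :: "int^'d^'d" and F \<zeta> G K and B :: "'b set" and \<xi>
    and \<pi> :: "'b \<Rightarrow> int^'d \<Rightarrow> 'a"
  assumes sub: "substitution A L F \<zeta>" and prim: "primitive A L F \<zeta>"
    and folF: "folner (supp L F)" and folG: "folner (supp L G)"
    and sub': "substitution B L G \<xi>"
    and finK: "finite K" and zeroK: "0 \<in> K"
    and GK: "g \<in> G \<Longrightarrow> k \<in> K \<Longrightarrow> \<exists>j\<in>K. \<exists>f\<in>F. g + k = L *v j + f"
    and block_in: "b \<in> B \<Longrightarrow> k \<in> K \<Longrightarrow> \<pi> b k \<in> A"
    and block_inj: "b \<in> B \<Longrightarrow> c \<in> B \<Longrightarrow> (\<And>k. k \<in> K \<Longrightarrow> \<pi> b k = \<pi> c k) \<Longrightarrow> b = c"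
    and block_step: "b \<in> B \<Longrightarrow> g \<in> G \<Longrightarrow> k \<in> K \<Longrightarrow> j \<in> K \<Longrightarrow> f \<in> F \<Longrightarrow> g + k = L *v j + f \<Longrightarrow>
          \<pi> (\<xi> b g) k = \<zeta> (\<pi> b j) f"
    and minimal: "C \<subseteq> B \<Longrightarrow> C \<noteq> {} \<Longrightarrow> (\<And>b g. b \<in> C \<Longrightarrow> g \<in> G \<Longrightarrow> \<xi> b g \<in> C) \<Longrightarrow> C = B"
    and nonempty: "A \<noteq> {} \<Longrightarrow> B \<noteq> {}"
begin

section \<open>Iterating the block substitution: language and primitivity\<close>

abbreviation "sb \<equiv> apply_subst L F \<zeta>"
abbreviation "it \<equiv> iterate L F \<zeta>"
abbreviation "it' \<equiv> iterate L G \<xi>"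

definition pat :: "'b \<Rightarrow> (int^'d \<rightharpoonup> 'a)" where
  "pat b = (\<lambda>k. if k \<in> K then Some (\<pi> b k) else None)"

lemma dom_pat: "dom (pat b) = K"
  by (auto simp: pat_def dom_def)

lemma ran_pat: "b \<in> B \<Longrightarrow> ran (pat b) \<subseteq> A"
  by (auto simp: pat_def ran_def block_in split: if_splits)

text \<open>At \<open>m = L *v i + g\<close> the window position \<open>k\<close> gives
  \<open>m + k = L *v (i + j) + f\<close>, and \<open>GK\<close> keeps \<open>j\<close> inside
  \<open>K\<close>. So the source letter at \<open>i + j\<close> is one that the symbol
  \<open>v i\<close> describes.\<close>

lemma overlays_apply_subst:
  assumes "overlays K \<pi> v w" "ran v \<subseteq> B"
  shows "overlays K \<pi> (apply_subst L G \<xi> v) (sb w)"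
  unfolding overlays_def
proof (intro allI impI ballI)
  fix m c k assume m: "apply_subst L G \<xi> v m = Some c" and k: "k \<in> K"
  obtain i g where ig: "g \<in> G" "m = L *v i + g"
    using decomp_ex[OF sub'] by blast
  obtain b where b: "v i = Some b" "c = \<xi> b g"
    using m by (auto simp: ig apply_subst_eq[OF sub'])
  obtain j f where jf: "j \<in> K" "f \<in> F" "g + k = L *v j + f"
    using GK[OF ig(1) k] by blast
  have "b \<in> B" using b(1) assms(2) by (auto simp: ran_def)
  have "m + k = L *v (i + j) + f"
    using jf(3) by (simp add: ig(2) matrix_vector_right_distrib add.assoc)
  moreover have "w (i + j) = Some (\<pi> b j)"
    using assms(1) b(1) jf(1) by (auto simp: overlays_def)
  ultimately show "sb w (m + k) = Some (\<pi> c k)"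
    by (simp add: apply_subst_eq[OF sub] jf(2) b(2) block_step[OF \<open>b \<in> B\<close> ig(1) k jf])
qed

lemma overlays_iterate:
  assumes "b \<in> B"
  shows "overlays K \<pi> (it' n b) ((sb ^^ n) (pat b))"
proof (induction n)
  case 0
  then show ?case by (auto simp: overlays_def pat_def split: if_splits)
next
  case (Suc n)
  then show ?case
    using overlays_apply_subst[OF Suc ran_iterate[OF sub' assms]] by (simp add: iterate_eq_funpow)
qed

lemma iterate_letter:
  assumes "b \<in> B" "m \<in> supp L G n"
  obtains c where "c \<in> B" "it' n b m = Some c" "\<And>k. k \<in> K \<Longrightarrow> (sb ^^ n) (pat b) (m + k) = Some (\<pi> c k)"
proof -
  obtain c where c: "it' n b m = Some c"
    using assms(2) dom_iterate[OF sub', of n b] by auto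
  moreover have "c \<in> B"
    using c ran_iterate[OF sub' assms(1)] by (auto simp: ran_def)
  moreover have "(sb ^^ n) (pat b) (m + k) = Some (\<pi> c k)" if "k \<in> K" for k
    using overlays_iterate[OF assms(1)] c that by (auto simp: overlays_def)
  ultimately show thesis by (blast intro: that)
qed

text \<open>For large \<open>n\<close> the set \<open>supp L G n\<close> contains a translate of the difference set of \<open>supp L F k\<close>,
  hence a full coset piece \<open>L\<^sup>k j + supp L F k\<close>, on which \<open>\<zeta>\<^sup>n\<close> of a block is \<open>\<zeta>\<^sup>k\<close> of a letter.\<close>

lemma occurs_inside:
  assumes a: "a \<in> A" and u: "occurs u (it m a)"
  shows "\<forall>\<^sub>F n in sequentially. \<forall>b\<in>B. \<exists>t. u \<subseteq>\<^sub>m (\<lambda>k. (sb ^^ n) (pat b) (k + t)) \<and>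
           (\<forall>k\<in>dom u. k + t \<in> supp L G n)"
proof -
  obtain k where k: "\<And>c. c \<in> A \<Longrightarrow> occurs u (it k c)"
    using eventually_happens'[OF sequentially_bot occurs_iterate_eventually[OF sub prim a u]] by blast
  have fin: "finite (supp L F k)"
    using folF by (simp add: folner_def)
  \<comment> \<open>The remainder \<open>f\<close> of \<open>t\<close> is not known in advance.
    Allowing all differences \<open>f' - f\<close> reaches the whole cell of \<open>t\<close>
    whatever \<open>f\<close> is.\<close>
  define D where "D = (\<lambda>(f, f'). f' - f) ` (supp L F k \<times> supp L F k)"
  have "0 \<in> F" "0 \<in> G"
    using sub sub' by (simp_all add: substitution_def)
  then have zF: "0 \<in> supp L F k" and zG: "supp L G n \<noteq> {}" for n
    using zero_in_supp[of F L k] zero_in_supp[of G L n] by blast+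
  have "\<forall>\<^sub>F n in sequentially. \<exists>t. (+) t ` D \<subseteq> supp L G n"
    by (rule folner_translate[OF folG zG]) (simp add: D_def fin)
  moreover have "\<forall>\<^sub>F n in sequentially. n \<ge> k"
    by (rule eventually_ge_at_top)
  ultimately show ?thesis
  proof eventually_elim
    case (elim n)
    then obtain t where t: "(+) t ` D \<subseteq> supp L G n" by blast
    show ?case
    proof
      fix b assume b: "b \<in> B"
      obtain j f where jf: "f \<in> supp L F k" "t = ((*v) L ^^ k) j + f"
        using supp_decompE sub unfolding substitution_def by metis
      have in_G: "((*v) L ^^ k) j + f' \<in> supp L G n" if "f' \<in> supp L F k" for f'
      proof -
        have "f' - f \<in> D" using that jf(1) by (auto simp: D_def)
        then have "t + (f' - f) \<in> supp L G n" using t by blast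
        then show ?thesis by (simp add: jf(2))
      qed
      define w where "w = (sb ^^ (n - k)) (pat b)"
      have w: "(sb ^^ k) w = (sb ^^ n) (pat b)"
        using elim(2) by (simp add: w_def flip: funpow_add comp_apply[of "sb ^^ k"])
      \<comment> \<open>The corner of the cell lies in \<open>supp L G n\<close> because
        \<open>0\<close> is in \<open>supp L F k\<close>, and every position of
        \<open>supp L G n\<close> carries a letter. Its ancestor at \<open>j\<close> is the letter
        whose iterate fills the cell.\<close>
      have "(sb ^^ n) (pat b) (((*v) L ^^ k) j) \<noteq> None"
        using iterate_letter[OF b in_G[OF zF]] zeroK by (metis add_0_right option.distinct(1))
      then obtain c where c: "w j = Some c"
        using dom_funpow_apply_subst[OF sub, of k w j] w by auto
      have "c \<in> A"
        using c ran_funpow_apply_subst[OF sub ran_pat[OF b]] unfolding w_def ran_def by blast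
      then obtain s where s: "u \<subseteq>\<^sub>m (\<lambda>x. it k c (x + s))"
        using k unfolding occurs_def by blast
      show "\<exists>t. u \<subseteq>\<^sub>m (\<lambda>k. (sb ^^ n) (pat b) (k + t)) \<and> (\<forall>k\<in>dom u. k + t \<in> supp L G n)"
      proof (intro exI[of _ "s + ((*v) L ^^ k) j"] conjI ballI)
        have dom: "x + s \<in> supp L F k" if "x \<in> dom u" for x
        proof -
          have "x + s \<in> dom (it k c)"
            using s that by (auto simp: map_le_def dom_def)
          then show ?thesis by (simp add: dom_iterate[OF sub])
        qed
        show "x + (s + ((*v) L ^^ k) j) \<in> supp L G n" if "x \<in> dom u" for x
          using in_G[OF dom[OF that]] by (simp add: algebra_simps)
        have "it k c \<subseteq>\<^sub>m (\<lambda>x. (sb ^^ n) (pat b) (x + ((*v) L ^^ k) j))"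
          using iterate_map_le[OF sub, of w j c k] c w by simp
        then show "u \<subseteq>\<^sub>m (\<lambda>x. (sb ^^ n) (pat b) (x + (s + ((*v) L ^^ k) j)))"
          using s dom unfolding map_le_def by (simp add: dom_iterate[OF sub] add.assoc)
      qed
    qed
  qed
qed

text \<open>The blocks occurring in iterates of letters form a set \<open>C\<close> that
  \<open>minimal\<close> forces to be \<open>B\<close>. It is closed because the block of
  \<open>\<xi> b g\<close> sits at \<open>g\<close> in the image of \<open>pat b\<close>. It is
  nonempty because, by the Folner property of \<open>supp L F\<close>, some iterate of a letter
  contains a pattern of shape \<open>K\<close>; \<open>occurs_inside\<close> finds this pattern at a
  position of \<open>supp L G n\<close>, where it is read as a symbol of \<open>B\<close>.\<close>

lemma pat_occurs:
  assumes "b \<in> B"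
  obtains n a where "a \<in> A" "occurs (pat b) (it n a)"
proof -
  define C where "C = {b \<in> B. \<exists>n. \<exists>a\<in>A. occurs (pat b) (it n a)}"
  have ne: "C \<noteq> {}"
  proof -
    obtain a where a: "a \<in> A"
      using block_in[OF assms zeroK] by blast
    have "\<forall>\<^sub>F n in sequentially. \<exists>t. (+) t ` K \<subseteq> supp L F n"
    proof (rule folner_translate[OF folF _ finK])
      show "supp L F n \<noteq> {}" for n
        using zero_in_supp[of F L n] sub unfolding substitution_def by blast
    qed
    then obtain n t where t: "(+) t ` K \<subseteq> supp L F n"
      using eventually_happens'[OF sequentially_bot] by blast
    define u where "u = (\<lambda>k. it n a (k + t)) |` K"
    have "t + k \<in> dom (it n a)" if "k \<in> K" for k
      using t that unfolding dom_iterate[OF sub] by blast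
    then have dom: "dom u = K"
      by (auto simp: u_def restrict_map_def dom_def add.commute split: if_splits)
    have u: "occurs u (it n a)"
      unfolding occurs_def u_def by (rule exI[of _ t]) (simp add: map_le_def)
    from eventually_happens'[OF sequentially_bot occurs_inside[OF a u]] assms
    obtain n' t' where t': "u \<subseteq>\<^sub>m (\<lambda>k. (sb ^^ n') (pat b) (k + t'))" "\<forall>k\<in>dom u. k + t' \<in> supp L G n'"
      by blast
    then have "t' \<in> supp L G n'" using zeroK dom by force
    from iterate_letter[OF assms this] obtain c
      where c: "c \<in> B" "\<And>k. k \<in> K \<Longrightarrow> (sb ^^ n') (pat b) (t' + k) = Some (\<pi> c k)"
      by blast
    have "pat c = u"
    proof
      fix k
      show "pat c k = u k"
      proof (cases "k \<in> K")
        case True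
        then have "u k = (sb ^^ n') (pat b) (k + t')"
          using t'(1) unfolding map_le_def dom by blast
        with c(2)[OF True] True show ?thesis by (simp add: pat_def add.commute)
      next
        case False
        with dom show ?thesis by (auto simp: pat_def)
      qed
    qed
    then show ?thesis using c(1) u a by (auto simp: C_def)
  qed
  have "C = B"
  proof (rule minimal[OF _ ne])
    show "C \<subseteq> B" by (auto simp: C_def)
    fix b g assume b: "b \<in> C" and g: "g \<in> G"
    then obtain n a where a: "b \<in> B" "a \<in> A" "occurs (pat b) (it n a)"
      by (auto simp: C_def)
    have g1: "g \<in> supp L G (Suc 0)" using g by (simp only: supp_1)
    have "it' (Suc 0) b g = Some (\<xi> b g)"
      using g iterate_1[OF sub'] by blast
    moreover obtain c where "it' (Suc 0) b g = Some c"
      "\<And>k. k \<in> K \<Longrightarrow> (sb ^^ Suc 0) (pat b) (g + k) = Some (\<pi> c k)"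
      using iterate_letter[OF a(1) g1] by blast
    ultimately have "sb (pat b) (g + k) = Some (\<pi> (\<xi> b g) k)" if "k \<in> K" for k
      using that by simp
    then have "occurs (pat (\<xi> b g)) (sb (pat b))"
      unfolding occurs_def by (intro exI[of _ g]) (auto simp: map_le_def pat_def add.commute)
    moreover have "occurs (sb (pat b)) (it (Suc n) a)"
      using occurs_funpow_apply_subst[OF sub a(3), of 1] by (simp add: iterate_eq_funpow)
    ultimately have "occurs (pat (\<xi> b g)) (it (Suc n) a)"
      by (rule occurs_trans)
    then show "\<xi> b g \<in> C"
      using a g sub' unfolding C_def substitution_def by blast
  qed
  then have "b \<in> C" using assms by simp
  then show thesis using that unfolding C_def by blast
qed

text \<open>Each block occurs in an iterate of a letter, so \<open>occurs_inside\<close> finds it in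
  the iterates of every block at a place where the iterate of \<open>\<xi>\<close> carries a symbol,
  and \<open>block_inj\<close> identifies that symbol. Finiteness of \<open>B\<close> yields a
  common exponent.\<close>

lemma primitive_recoding: "primitive B L G \<xi>"
proof -
  have "\<forall>\<^sub>F n in sequentially. \<forall>b\<in>B. c \<in> ran (it' n b)" if c: "c \<in> B" for c
  proof -
    obtain m a where a: "a \<in> A" "occurs (pat c) (it m a)"
      using pat_occurs[OF c] by blast
    from occurs_inside[OF this] show ?thesis
    proof eventually_elim
      case (elim n)
      show ?case
      proof
        fix b assume b: "b \<in> B"
        with elim obtain t where t: "pat c \<subseteq>\<^sub>m (\<lambda>k. (sb ^^ n) (pat b) (k + t))"
          and "\<forall>k\<in>K. k + t \<in> supp L G n"
          unfolding dom_pat by blast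
        then have tG: "t \<in> supp L G n" using zeroK by force
        obtain c' where c': "c' \<in> B" "it' n b t = Some c'"
          "\<And>k. k \<in> K \<Longrightarrow> (sb ^^ n) (pat b) (t + k) = Some (\<pi> c' k)"
          using iterate_letter[OF b tG] by blast
        have "c = c'"
        proof (rule block_inj[OF c c'(1)])
          fix k assume k: "k \<in> K"
          then have "k \<in> dom (pat c)" by (simp add: dom_pat)
          then have "pat c k = (sb ^^ n) (pat b) (k + t)"
            using t unfolding map_le_def by blast
          then show "\<pi> c k = \<pi> c' k"
            using c'(3)[OF k] k by (simp add: pat_def add.commute)
        qed
        with c'(2) show "c \<in> ran (it' n b)" by (auto simp: ran_def)
      qed
    qed
  qed
  then have "\<forall>\<^sub>F n in sequentially. \<forall>c\<in>B. \<forall>b\<in>B. c \<in> ran (it' n b)"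
    using sub' by (intro eventually_ball_finite) (auto simp: substitution_def)
  then have "\<forall>\<^sub>F n in sequentially. n > 0 \<and> (\<forall>c\<in>B. \<forall>b\<in>B. c \<in> ran (it' n b))"
    using eventually_gt_at_top by (rule eventually_conj[rotated])
  then show ?thesis
    unfolding primitive_def using eventually_happens'[OF sequentially_bot] by blast
qed

section \<open>The conjugacy: reading through the window, and its inverse\<close>

definition recode :: "(int^'d \<Rightarrow> 'a) \<Rightarrow> (int^'d \<Rightarrow> 'b)" where
  "recode x = (\<lambda>m. THE b. b \<in> B \<and> (\<forall>k\<in>K. \<pi> b k = x (m + k)))"

definition decode :: "(int^'d \<Rightarrow> 'b) \<Rightarrow> (int^'d \<Rightarrow> 'a)" where
  "decode y = (\<lambda>m. \<pi> (y m) 0)"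

abbreviation "X \<equiv> subst_shift A L F \<zeta>"
abbreviation "Y \<equiv> subst_shift B L G \<xi>"

text \<open>The definition of \<open>X\<close> only places a window in the iterate of a letter.
  Moving it into the iterate of a block, at positions of \<open>supp L G n\<close>, is what allows
  block symbols to be read there.\<close>

lemma window_occurs:
  assumes x: "x \<in> X" and D: "finite D"
  shows "\<exists>b\<in>B. \<exists>n>0. \<exists>t. \<forall>k\<in>D. (sb ^^ n) (pat b) (k + t) = Some (x k) \<and> k + t \<in> supp L G n"
proof -
  define u where "u = (Some \<circ> x) |` D"
  have dom: "dom u = D" by (auto simp: u_def)
  have "occurs u (Some \<circ> x)"
    by (rule occurs_map_le) (simp add: u_def map_le_def)
  then obtain m a where a: "a \<in> A" "occurs u (it m a)"
    using x D dom by (auto simp: subst_shift_def)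
  obtain b where b: "b \<in> B" using nonempty a(1) by blast
  have "\<forall>\<^sub>F n in sequentially. n > 0 \<and> (\<forall>b\<in>B. \<exists>t. u \<subseteq>\<^sub>m (\<lambda>k. (sb ^^ n) (pat b) (k + t)) \<and>
      (\<forall>k\<in>dom u. k + t \<in> supp L G n))"
    using occurs_inside[OF a] eventually_gt_at_top by (rule eventually_conj[rotated])
  from eventually_happens'[OF sequentially_bot this] b
  obtain n t where n: "n > 0" "u \<subseteq>\<^sub>m (\<lambda>k. (sb ^^ n) (pat b) (k + t))"
    "\<forall>k\<in>dom u. k + t \<in> supp L G n"
    by blast
  have "(sb ^^ n) (pat b) (k + t) = Some (x k)" if "k \<in> D" for k
    using n(2) that dom by (auto simp: map_le_def u_def)
  with n dom b show ?thesis by blast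
qed

text \<open>The definite description in \<open>recode\<close> is legitimate on \<open>X\<close>: the
  window at \<open>m\<close> is found in an iterate of a block at a position of
  \<open>supp L G n\<close>, hence is named by a symbol of \<open>B\<close>, unique by
  \<open>block_inj\<close>.\<close>

lemma recode:
  assumes x: "x \<in> X"
  shows "recode x m \<in> B" "k \<in> K \<Longrightarrow> \<pi> (recode x m) k = x (m + k)"
proof -
  obtain b n t where *: "b \<in> B" "\<forall>k\<in>(+) m ` K. (sb ^^ n) (pat b) (k + t) = Some (x k) \<and> k + t \<in> supp L G n"
    using window_occurs[OF x, of "(+) m ` K"] finK by blast
  then have "m + t \<in> supp L G n" using zeroK by force
  from iterate_letter[OF *(1) this] obtain c
    where c: "c \<in> B" "\<And>k. k \<in> K \<Longrightarrow> (sb ^^ n) (pat b) (m + t + k) = Some (\<pi> c k)"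
    by blast
  have "\<pi> c k = x (m + k)" if "k \<in> K" for k
  proof -
    have "m + k \<in> (+) m ` K" using that by simp
    then have "(sb ^^ n) (pat b) (m + k + t) = Some (x (m + k))" using * by blast
    with c(2)[OF that] show ?thesis by (simp add: ac_simps)
  qed
  then have ex: "c \<in> B \<and> (\<forall>k\<in>K. \<pi> c k = x (m + k))" using c(1) by blast
  have "recode x m \<in> B \<and> (\<forall>k\<in>K. \<pi> (recode x m) k = x (m + k))"
    unfolding recode_def
    by (rule theI[where P = "\<lambda>b. b \<in> B \<and> (\<forall>k\<in>K. \<pi> b k = x (m + k))", OF ex])
       (rule block_inj; use ex in simp)
  then show "recode x m \<in> B" "k \<in> K \<Longrightarrow> \<pi> (recode x m) k = x (m + k)" by blast+
qed

lemma decode_recode: "x \<in> X \<Longrightarrow> decode (recode x) = x"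
  by (simp add: decode_def recode zeroK)

lemma recode_in:
  assumes x: "x \<in> X"
  shows "recode x \<in> Y"
  unfolding subst_shift_def
proof (safe)
  show "recode x m \<in> B" for m by (rule recode[OF x])
next
  fix v assume fin: "finite (dom v)" and v: "occurs v (Some \<circ> recode x)"
  then obtain s where s: "v \<subseteq>\<^sub>m (\<lambda>k. Some (recode x (k + s)))"
    by (auto simp: occurs_def)
  \<comment> \<open>All positions that the symbols of \<open>v\<close> look at. A single iterate
    must show them together, so that one offset serves every \<open>p\<close>.\<close>
  define D where "D = (\<lambda>(p, k). p + s + k) ` (dom v \<times> K)"
  have "finite D" using fin finK by (simp add: D_def)
  from window_occurs[OF x this] obtain b n t where *: "b \<in> B" "n > 0"
    "\<And>k. k \<in> D \<Longrightarrow> (sb ^^ n) (pat b) (k + t) = Some (x k) \<and> k + t \<in> supp L G n"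
    by blast
  have "v \<subseteq>\<^sub>m (\<lambda>p. it' n b (p + (s + t)))"
    unfolding map_le_def
  proof
    fix p assume p: "p \<in> dom v"
    have D: "p + s + k \<in> D" if "k \<in> K" for k
      using p that unfolding D_def by force
    have "p + s + t \<in> supp L G n"
      using *(3)[OF D[OF zeroK]] by simp
    from iterate_letter[OF *(1) this] obtain c where c: "c \<in> B" "it' n b (p + s + t) = Some c"
      "\<And>k. k \<in> K \<Longrightarrow> (sb ^^ n) (pat b) (p + s + t + k) = Some (\<pi> c k)"
      by blast
    have "recode x (p + s) = c"
    proof (rule block_inj[OF recode(1)[OF x] c(1)])
      fix k assume k: "k \<in> K"
      show "\<pi> (recode x (p + s)) k = \<pi> c k"
        using c(3)[OF k] *(3)[OF D[OF k]] recode(2)[OF x k, of "p + s"] by (simp add: algebra_simps)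
    qed
    moreover have "v p = Some (recode x (p + s))"
      using s p by (auto simp: map_le_def)
    ultimately show "v p = it' n b (p + (s + t))"
      using c(2) by (simp add: add.assoc)
  qed
  then show "\<exists>n>0. \<exists>b\<in>B. occurs v (it' n b)"
    using *(1,2) unfolding occurs_def by blast
qed

lemma window_decode:
  assumes y: "y \<in> Y" and D: "finite D"
  shows "\<exists>b\<in>B. \<exists>n>0. \<exists>t. \<forall>p\<in>D. \<forall>k\<in>K. (sb ^^ n) (pat b) (p + t + k) = Some (\<pi> (y p) k)"
proof -
  define v where "v = (Some \<circ> y) |` D"
  have dom: "dom v = D" by (auto simp: v_def)
  have "occurs v (Some \<circ> y)"
    by (rule occurs_map_le) (simp add: v_def map_le_def)
  then obtain n b where b: "b \<in> B" "n > 0" "occurs v (it' n b)"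
    using y D dom by (auto simp: subst_shift_def)
  then obtain t where t: "v \<subseteq>\<^sub>m (\<lambda>k. it' n b (k + t))"
    by (auto simp: occurs_def)
  have "(sb ^^ n) (pat b) (p + t + k) = Some (\<pi> (y p) k)" if p: "p \<in> D" and k: "k \<in> K" for p k
  proof -
    have "v p = Some (y p)" using p by (simp add: v_def)
    moreover have "v p = it' n b (p + t)"
      using t p dom by (auto simp: map_le_def)
    ultimately show ?thesis
      using overlays_iterate[OF b(1), of n] k by (auto simp: overlays_def)
  qed
  with b show ?thesis by blast
qed

text \<open>The symbols of \<open>y\<close> are consistent because both are read in a single
  iterate: the letter at \<open>m + k\<close> is entry \<open>k\<close> of the block at
  \<open>m\<close> and entry \<open>0\<close> of the block at \<open>m + k\<close>.\<close>

lemma decode_block: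
  assumes y: "y \<in> Y" and k: "k \<in> K"
  shows "\<pi> (y m) k = decode y (m + k)"
proof -
  have "finite {m, m + k}" by simp
  from window_decode[OF y this] obtain b n t where
    *: "\<forall>p\<in>{m, m + k}. \<forall>k\<in>K. (sb ^^ n) (pat b) (p + t + k) = Some (\<pi> (y p) k)"
    by blast
  have "(sb ^^ n) (pat b) (m + t + k) = Some (\<pi> (y m) k)"
    using * k by blast
  moreover have "(sb ^^ n) (pat b) (m + k + t + 0) = Some (\<pi> (y (m + k)) 0)"
    using * zeroK by blast
  ultimately show ?thesis by (simp add: decode_def ac_simps)
qed

lemma range_Y: "y \<in> Y \<Longrightarrow> y m \<in> B"
  by (auto simp: subst_shift_def)

lemma decode_in:
  assumes y: "y \<in> Y"
  shows "decode y \<in> X"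
  unfolding subst_shift_def
proof (safe)
  show "decode y m \<in> A" for m
    using range_Y[OF y] zeroK by (simp add: decode_def block_in)
next
  fix u assume fin: "finite (dom u)" and u: "occurs u (Some \<circ> decode y)"
  then obtain s where s: "u \<subseteq>\<^sub>m (\<lambda>k. Some (decode y (k + s)))"
    by (auto simp: occurs_def)
  have "finite ((\<lambda>k. k + s) ` dom u)" using fin by simp
  from window_decode[OF y this] obtain b n t where b: "b \<in> B" "n > 0"
    "\<forall>p\<in>(\<lambda>k. k + s) ` dom u. \<forall>k\<in>K. (sb ^^ n) (pat b) (p + t + k) = Some (\<pi> (y p) k)"
    by blast
  have "u p = (sb ^^ n) (pat b) (p + (s + t))" if p: "p \<in> dom u" for p
  proof -
    have "(sb ^^ n) (pat b) (p + s + t + 0) = Some (\<pi> (y (p + s)) 0)"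
      using b(3) p zeroK by blast
    then show ?thesis
      using s p by (simp add: map_le_def decode_def add.assoc)
  qed
  then have "occurs u ((sb ^^ n) (pat b))"
    unfolding occurs_def map_le_def by blast
  \<comment> \<open>Membership in \<open>X\<close> refers to iterates of letters, not of blocks.
    Since \<open>pat b\<close> occurs in an iterate of a letter, the exponents add up.\<close>
  moreover obtain m a where a: "a \<in> A" "occurs (pat b) (it m a)"
    using pat_occurs[OF b(1)] by blast
  ultimately have "occurs u (it (n + m) a)"
    unfolding iterate_add using occurs_funpow_apply_subst[OF sub a(2)] occurs_trans by blast
  then show "\<exists>n>0. \<exists>a\<in>A. occurs u (it n a)"
    using a(1) b(2) by (intro exI[of _ "n + m"]) auto
qed

lemma recode_decode:
  assumes y: "y \<in> Y"
  shows "recode (decode y) = y"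
proof
  fix m show "recode (decode y) m = y m"
    by (rule block_inj) (simp_all add: recode[OF decode_in[OF y]] decode_block[OF y] range_Y[OF y])
qed

lemma aperiodic_recoding:
  assumes "aperiodic A L F \<zeta>"
  shows "aperiodic B L G \<xi>"
  unfolding aperiodic_def
proof (intro ballI allI impI)
  fix y p assume y: "y \<in> Y" and "shift p y = y"
  then have "y (p + m) = y m" for m
    by (metis shift_def)
  then have "shift p (decode y) = decode y"
    by (simp add: shift_def decode_def)
  with assms decode_in[OF y] show "p = 0"
    by (auto simp: aperiodic_def)
qed

lemma recode_shift:
  "recode (shift n x) = shift n (recode x)"
  by (simp add: recode_def shift_def add.assoc)

end

text \<open>The easy direction of the Curtis-Hedlund-Lyndon theorem: a coordinate of the image that
  depends on finitely many coordinates is constant on cylinders, and cylinders are open.\<close>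

lemma continuous_map_local:
  fixes h :: "(int^'d \<Rightarrow> 'a) \<Rightarrow> (int^'e \<Rightarrow> 'b)"
  assumes "X \<subseteq> {x. range x \<subseteq> A}" "\<And>x. x \<in> X \<Longrightarrow> h x \<in> Y" "Y \<subseteq> {y. range y \<subseteq> B}"
    and "\<And>m. \<exists>D. finite D \<and> (\<forall>x\<in>X. \<forall>x'\<in>X. (\<forall>k\<in>D. x k = x' k) \<longrightarrow> h x m = h x' m)"
  shows "continuous_map (subtopology (config_topology A) X) (subtopology (config_topology B) Y) h"
proof -
  have XA: "x k \<in> A" if "x \<in> X" for x k
    using assms(1) that by auto
  have YB: "h x k \<in> B" if "x \<in> X" for x k
    using assms(3) assms(2)[OF that] by auto
  have "X \<subseteq> topspace (config_topology A)"
    by (rule subsetI) (simp add: config_topology_def PiE_UNIV_domain XA)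
  then have top: "topspace (subtopology (config_topology A) X) = X"
    by (rule topspace_subtopology_subset)
  have "continuous_map (subtopology (config_topology A) X) (discrete_topology B) (\<lambda>x. h x m)" for m
    unfolding continuous_map_alt
  proof (intro conjI allI impI)
    show "(\<lambda>x. h x m) \<in> topspace (subtopology (config_topology A) X) \<rightarrow> topspace (discrete_topology B)"
      using YB top by auto
    fix V :: "'b set"
    obtain D where D: "finite D" "\<forall>x\<in>X. \<forall>x'\<in>X. (\<forall>k\<in>D. x k = x' k) \<longrightarrow> h x m = h x' m"
      using assms(4)[of m] by (elim exE conjE)
    let ?U = "(\<lambda>x. h x m) -` V \<inter> topspace (subtopology (config_topology A) X)"
    show "openin (subtopology (config_topology A) X) ?U"
    proof (subst openin_subopen, intro ballI)
      fix x assume x: "x \<in> ?U"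
      then have xX: "x \<in> X" by (simp only: top) simp
      define W where "W = (\<Pi>\<^sub>E k\<in>UNIV. if k \<in> D then {x k} else A)"
      have "finite {k. (if k \<in> D then {x k} else A) \<noteq> A}"
        by (rule finite_subset[OF _ D(1)]) auto
      then have "openin (config_topology A) W"
        by (auto simp: config_topology_def W_def openin_PiE_gen XA[OF xX])
      then have "openin (subtopology (config_topology A) X) (X \<inter> W)"
        by (rule openin_subtopology_Int2)
      moreover have "x \<in> X \<inter> W"
        using xX XA by (auto simp: W_def)
      moreover have "X \<inter> W \<subseteq> ?U"
      proof
        fix x' assume x': "x' \<in> X \<inter> W"
        then have "x' k \<in> (if k \<in> D then {x k} else A)" for k
          unfolding W_def PiE_UNIV_domain by blast
        then have "\<forall>k\<in>D. x k = x' k" by (metis singletonD)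
        then have "h x m = h x' m" using D(2) xX x' by blast
        with x x' show "x' \<in> ?U" unfolding top by auto
      qed
      ultimately show "\<exists>T. openin (subtopology (config_topology A) X) T \<and> x \<in> T \<and> T \<subseteq> ?U"
        by blast
    qed
  qed
  then have "continuous_map (subtopology (config_topology A) X) (config_topology B) h"
    unfolding config_topology_def[of B] continuous_map_componentwise_UNIV by blast
  then show ?thesis
    using assms(2) top by (simp add: continuous_map_in_subtopology Pi_def)
qed

context block_recoding begin

lemma conjugate_recoding: "conjugate A X B Y"
  unfolding conjugate_def
proof (intro exI conjI allI ballI)
  show "recode (shift n x) = shift n (recode x)" for n x
    by (rule recode_shift)
  have XA: "X \<subseteq> {x. range x \<subseteq> A}" and YB: "Y \<subseteq> {y. range y \<subseteq> B}"
    by (auto simp: subst_shift_def)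
  have "homeomorphic_maps (subtopology (config_topology A) X) (subtopology (config_topology B) Y) recode decode"
    unfolding homeomorphic_maps_def
  proof (intro conjI ballI)
    show "continuous_map (subtopology (config_topology A) X) (subtopology (config_topology B) Y) recode"
    proof (rule continuous_map_local[OF XA recode_in YB])
      fix m
      have "recode x m = recode x' m" if "\<forall>k\<in>(+) m ` K. x k = x' k" for x x'
        using that by (simp add: recode_def)
      then show "\<exists>D. finite D \<and> (\<forall>x\<in>X. \<forall>x'\<in>X. (\<forall>k\<in>D. x k = x' k) \<longrightarrow> recode x m = recode x' m)"
        using finK by blast
    qed
    show "continuous_map (subtopology (config_topology B) Y) (subtopology (config_topology A) X) decode"
    proof (rule continuous_map_local[OF YB decode_in XA])
      show "\<exists>D. finite D \<and> (\<forall>x\<in>Y. \<forall>x'\<in>Y. (\<forall>k\<in>D. x k = x' k) \<longrightarrow> decode x m = decode x' m)" for m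
        by (rule exI[of _ "{m}"]) (simp add: decode_def)
    qed
  qed (auto simp: decode_recode recode_decode)
  then show "homeomorphic_map (subtopology (config_topology A) X) (subtopology (config_topology B) Y) recode"
    by (rule homeomorphic_maps_imp_map)
qed

end

lemma ex_window:
  fixes L :: "int^'d^'d"
  assumes L: "expansion_matrix L" and F: "fundamental_domain L F" "finite F" and G: "finite G"
  obtains K where "finite K" "0 \<in> K" "\<And>g k. g \<in> G \<Longrightarrow> k \<in> K \<Longrightarrow> \<exists>j\<in>K. \<exists>f\<in>F. g + k = L *v j + f"
proof -
  define r :: "int^'d \<Rightarrow> real^'d" where "r v = (\<chi> i. real_of_int (v $ i))" for v
  have r_add: "r (v + w) = r v + r w" and r_diff: "r (v - w) = r v - r w" for v w
    by (simp_all add: r_def vec_eq_iff)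
  have r_L: "r (L *v v) = map_matrix real_of_int L *v r v" for v
    by (simp add: r_def vec_eq_iff matrix_vector_mult_def)
  obtain c where c: "c > 1" "\<And>x :: real^'d. x \<noteq> 0 \<Longrightarrow> norm (map_matrix real_of_int L *v x) > c * norm x"
    using L by (auto simp: expansion_matrix_def)
  have exp: "c * norm (r v) \<le> norm (r (L *v v))" for v
    using c(2)[of "r v"] unfolding r_L by (cases "r v = 0") auto
  define M where "M = (\<Sum>g\<in>G. norm (r g)) + (\<Sum>f\<in>F. norm (r f))"
  \<comment> \<open>The radius solves \<open>(R + M) / c = R\<close>, where \<open>M\<close> is a
    crude bound for \<open>norm (r g) + norm (r f)\<close>. Hence solving
    \<open>g + k = L *v j + f\<close> for \<open>j\<close> does not leave the ball.\<close>
  define R where "R = M / (c - 1)"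
  have M0: "M \<ge> 0" by (simp add: M_def sum_nonneg add_nonneg_nonneg)
  have R0: "R \<ge> 0" using M0 c(1) by (simp add: R_def)
  have "R * (c - 1) = M" using c(1) by (simp add: R_def)
  then have RM: "R + M = c * R" by (simp add: algebra_simps)
  define K where "K = {v. norm (r v) \<le> R}"
  have "finite K"
  proof (rule finite_subset)
    show "K \<subseteq> vec_lambda ` (UNIV \<rightarrow>\<^sub>E {- \<lceil>R\<rceil>..\<lceil>R\<rceil>})"
    proof
      fix v assume v: "v \<in> K"
      have le: "\<bar>real_of_int (v $ i)\<bar> \<le> R" for i
        using component_le_norm_cart[of "r v" i] v by (simp add: r_def K_def)
      have "v $ i \<in> {- \<lceil>R\<rceil>..\<lceil>R\<rceil>}" for i
      proof -
        have "real_of_int \<bar>v $ i\<bar> \<le> real_of_int \<lceil>R\<rceil>"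
          using le[of i] le_of_int_ceiling[of R] by linarith
        then have "\<bar>v $ i\<bar> \<le> \<lceil>R\<rceil>" by (simp only: of_int_le_iff)
        then show ?thesis by auto
      qed
      then have "vec_nth v \<in> UNIV \<rightarrow>\<^sub>E {- \<lceil>R\<rceil>..\<lceil>R\<rceil>}" by auto
      then show "v \<in> vec_lambda ` (UNIV \<rightarrow>\<^sub>E {- \<lceil>R\<rceil>..\<lceil>R\<rceil>})"
        by (metis image_eqI vec_nth_inverse)
    qed
    show "finite (vec_lambda ` (UNIV \<rightarrow>\<^sub>E {- \<lceil>R\<rceil>..\<lceil>R\<rceil>}))"
      by (intro finite_imageI finite_PiE) auto
  qed
  moreover have "0 \<in> K"
  proof -
    have "r 0 = 0" by (simp add: r_def vec_eq_iff)
    then show ?thesis using R0 by (simp add: K_def)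
  qed
  moreover have "\<exists>j\<in>K. \<exists>f\<in>F. g + k = L *v j + f" if g: "g \<in> G" and k: "k \<in> K" for g k
  proof -
    obtain f where f: "f \<in> F" "(g + k) - f \<in> range ((*v) L)"
      using F(1) unfolding fundamental_domain_def by metis
    then obtain j where j: "(g + k) - f = L *v j" by blast
    have "norm (r g) \<le> (\<Sum>g\<in>G. norm (r g))" "norm (r f) \<le> (\<Sum>f\<in>F. norm (r f))"
      using g f(1) G F(2) by (auto intro!: member_le_sum)
    moreover have "c * norm (r j) \<le> norm (r g) + norm (r k) + norm (r f)"
    proof -
      have "c * norm (r j) \<le> norm (r g + r k - r f)"
        using exp[of j] unfolding j[symmetric] by (simp add: r_add r_diff)
      also have "\<dots> \<le> norm (r g + r k) + norm (r f)" by (rule norm_triangle_ineq4)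
      finally show ?thesis using norm_triangle_ineq[of "r g" "r k"] by linarith
    qed
    ultimately have "c * norm (r j) \<le> c * R"
      using k RM by (simp add: K_def M_def)
    then have "j \<in> K" using c(1) by (simp add: K_def)
    moreover have "g + k = L *v j + f" using j by (simp add: algebra_simps)
    ultimately show ?thesis using f(1) by blast
  qed
  ultimately show thesis by (rule that)
qed

section \<open>Deciding codes of block recodings\<close>

text \<open>\<open>list_encode\<close> adds one to the code of head and tail, hence
  \<open>c - 1\<close>. The index is not part of the coded data: the dimension is fixed, so each
  entry may have its own program.\<close>

primrec list_nth :: "nat \<Rightarrow> nat \<Rightarrow> nat" where
  "list_nth c 0 = fst (prod_decode (c - 1))"
| "list_nth c (Suc i) = list_nth (snd (prod_decode (c - 1))) i"

lemma list_nth_encode: "i < length xs \<Longrightarrow> list_nth (list_encode xs) i = xs ! i"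
proof (induction xs arbitrary: i)
  case (Cons x xs)
  then show ?case by (cases i) auto
qed simp

lemma computable_list_nth: "computable n f \<Longrightarrow> computable n (\<lambda>xs. list_nth (f xs) i)"
proof (induction i arbitrary: f)
  case 0
  show ?case
    unfolding list_nth.simps
    by (intro computable_fst_prod_decode computable_diff 0 computable_const)
next
  case (Suc i)
  show ?case
    unfolding list_nth.simps
    by (intro Suc.IH computable_snd_prod_decode computable_diff Suc.prems computable_const)
qed

lemma computable_list_encode:
  assumes "\<And>i. i \<in> set is \<Longrightarrow> computable n (f i)"
  shows "computable n (\<lambda>xs. list_encode (map (\<lambda>i. f i xs) is))"
  using assms
  by (induction "is") (simp_all add: computable_const computable_Suc computable_prod_encode)

definition int_nth :: "nat \<Rightarrow> nat \<Rightarrow> int" where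
  "int_nth c i = int_decode (list_nth c i)"

lemma int_computable_nth: "computable n f \<Longrightarrow> int_computable n (\<lambda>xs. int_nth (f xs) i)"
  unfolding int_nth_def by (intro int_computable_decode computable_list_nth)

lemma int_nth_code_vec: "i < length ds \<Longrightarrow> int_nth (code_vec ds v) i = v $ (ds ! i)"
  by (simp add: int_nth_def code_vec_def list_nth_encode)

lemma list_nth_code_matrix: "i < length ds \<Longrightarrow> list_nth (code_matrix ds L) i = code_vec ds (L $ (ds ! i))"
  by (simp add: code_matrix_def list_nth_encode)

text \<open>Re-encoding the first \<open>d\<close> entries reproduces \<open>c\<close> exactly if
  \<open>c\<close> codes a list of length \<open>d\<close>. Every such list comes from an integer
  vector because \<open>int_encode\<close> is onto.\<close>

definition is_vec :: "nat \<Rightarrow> nat \<Rightarrow> bool" where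
  "is_vec d c \<longleftrightarrow> list_encode (map (list_nth c) [0..<d]) = c"

text \<open>The equation \<open>g + k = L *v j + f\<close> on codes, coordinate by
  coordinate.\<close>

definition same_cell :: "nat \<Rightarrow> nat \<Rightarrow> nat \<Rightarrow> nat \<Rightarrow> nat \<Rightarrow> nat \<Rightarrow> bool" where
  "same_cell d l g k j f \<longleftrightarrow>
     (\<forall>i\<in>set [0..<d]. int_nth g i + int_nth k i =
        (\<Sum>m\<leftarrow>[0..<d]. int_nth (list_nth l i) m * int_nth j m) + int_nth f i)"

definition triple :: "nat \<Rightarrow> nat \<Rightarrow> nat \<Rightarrow> nat" where
  "triple a b c = prod_encode (a, prod_encode (b, c))"

lemma triple_eq [simp]: "triple a b c = triple a' b' c' \<longleftrightarrow> a = a' \<and> b = b' \<and> c = c'"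
  by (simp add: triple_def)

text \<open>A block is stored as the graph of a function from \<open>K\<close> to
  \<open>A\<close>.\<close>

definition is_block :: "nat \<Rightarrow> nat \<Rightarrow> nat \<Rightarrow> bool" where
  "is_block K A b \<longleftrightarrow>
     (\<forall>t\<in>set_decode b. \<exists>k\<in>set_decode K. \<exists>a\<in>set_decode A. t = prod_encode (k, a)) \<and>
     (\<forall>k\<in>set_decode K. \<exists>a\<in>set_decode A. prod_encode (k, a) \<in> set_decode b \<and>
        (\<forall>a'\<in>set_decode A. prod_encode (k, a') \<in> set_decode b \<longrightarrow> a' = a))"

text \<open>\<open>c\<close> is the block of shape \<open>K\<close> at \<open>g\<close> in the image of the block \<open>b\<close> under the substitution
  with graph \<open>H\<close>.\<close>

definition block_step :: "nat \<Rightarrow> nat \<Rightarrow> nat \<Rightarrow> nat \<Rightarrow> nat \<Rightarrow> nat \<Rightarrow> nat \<Rightarrow> nat \<Rightarrow> nat \<Rightarrow> bool" where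
  "block_step d l F A H K b g c \<longleftrightarrow>
     (\<forall>k\<in>set_decode K. \<forall>j\<in>set_decode K. \<forall>f\<in>set_decode F. same_cell d l g k j f \<longrightarrow>
        (\<forall>a\<in>set_decode A. \<forall>a'\<in>set_decode A.
           prod_encode (j, a) \<in> set_decode b \<and> triple a f a' \<in> set_decode H \<longrightarrow>
           prod_encode (k, a') \<in> set_decode c))"

definition closed_under :: "nat \<Rightarrow> nat \<Rightarrow> nat \<Rightarrow> bool" where
  "closed_under G X C \<longleftrightarrow>
     (\<forall>b\<in>set_decode C. \<forall>g\<in>set_decode G. \<exists>c\<in>set_decode C. triple b g c \<in> set_decode X)"

definition is_window :: "nat \<Rightarrow> nat \<Rightarrow> nat \<Rightarrow> nat \<Rightarrow> nat \<Rightarrow> nat \<Rightarrow> bool" where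
  "is_window d z l F G K \<longleftrightarrow>
     (\<forall>k\<in>set_decode K. is_vec d k) \<and> z \<in> set_decode K \<and>
     (\<forall>g\<in>set_decode G. \<forall>k\<in>set_decode K. \<exists>j\<in>set_decode K. \<exists>f\<in>set_decode F. same_cell d l g k j f)"

text \<open>A subset of a coded set has a code at most as large (\<open>set_encode_mono\<close>), so
  the bounded quantifier reaches all subsets and the check is finite. The code 0 is that of the
  empty set.\<close>

definition is_minimal :: "nat \<Rightarrow> nat \<Rightarrow> nat \<Rightarrow> bool" where
  "is_minimal G X B \<longleftrightarrow>
     (\<forall>C\<le>B. (\<forall>c\<in>set_decode C. c \<in> set_decode B) \<and> C \<noteq> 0 \<and> closed_under G X C \<longrightarrow> C = B)"

text \<open>The certificate that is searched for; \<open>X\<close> is the graph of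
  \<open>\<xi>\<close>. Totality of \<open>\<xi>\<close> is \<open>closed_under\<close> for
  \<open>B\<close> itself, and single-valuedness follows from \<open>is_window\<close> and
  \<open>block_step\<close>, which determine the image block at every position of
  \<open>K\<close>.\<close>

definition is_recoding ::
    "nat \<Rightarrow> nat \<Rightarrow> nat \<Rightarrow> nat \<Rightarrow> nat \<Rightarrow> nat \<Rightarrow> nat \<Rightarrow> nat \<Rightarrow> nat \<Rightarrow> nat \<Rightarrow> bool" where
  "is_recoding d z l F A H G K B X \<longleftrightarrow>
     is_window d z l F G K \<and> (\<forall>b\<in>set_decode B. is_block K A b) \<and>
     (\<forall>t\<in>set_decode X. \<exists>b\<in>set_decode B. \<exists>g\<in>set_decode G. \<exists>c\<in>set_decode B.
        t = triple b g c \<and> block_step d l F A H K b g c) \<and>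
     closed_under G X B \<and> is_minimal G X B \<and> (B = 0 \<longrightarrow> A = 0)"

section \<open>Decidability of the checks\<close>

lemmas decidable_intros =
  decidable_conj decidable_imp decidable_ball decidable_bex decidable_mem decidable_not
  decidable_eq decidable_all_le computable_prod_encode

lemma computable_triple:
  assumes "computable n a" "computable n b" "computable n c"
  shows "computable n (\<lambda>xs. triple (a xs) (b xs) (c xs))"
  unfolding triple_def by (intro computable_prod_encode assms)

lemma decidable_is_vec:
  assumes "computable n c"
  shows "decidable n (\<lambda>xs. is_vec d (c xs))"
  unfolding is_vec_def
  by (intro decidable_eq computable_list_encode computable_list_nth assms)

lemma decidable_same_cell:
  assumes "computable n l" "computable n g" "computable n k" "computable n j" "computable n f"
  shows "decidable n (\<lambda>xs. same_cell d (l xs) (g xs) (k xs) (j xs) (f xs))"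
  unfolding same_cell_def
  by (intro decidable_all_list decidable_int_eq int_computable_add int_computable_sum_list
      int_computable_mult int_computable_nth computable_list_nth assms)

lemma decidable_is_block:
  assumes "computable n K" "computable n A" "computable n b"
  shows "decidable n (\<lambda>xs. is_block (K xs) (A xs) (b xs))"
  unfolding is_block_def
  by (intro decidable_intros computable_hd computable_tl assms)

lemma decidable_block_step:
  assumes "computable n l" "computable n F" "computable n A" "computable n H" "computable n K"
    "computable n b" "computable n g" "computable n c"
  shows "decidable n (\<lambda>xs. block_step d (l xs) (F xs) (A xs) (H xs) (K xs) (b xs) (g xs) (c xs))"
  unfolding block_step_def
  by (intro decidable_intros decidable_same_cell computable_triple computable_hd computable_tl assms)

lemma decidable_closed_under:
  assumes "computable n G" "computable n X" "computable n C"
  shows "decidable n (\<lambda>xs. closed_under (G xs) (X xs) (C xs))"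
  unfolding closed_under_def
  by (intro decidable_intros computable_triple computable_hd computable_tl assms)

lemma decidable_is_window:
  assumes "computable n l" "computable n F" "computable n G" "computable n K"
  shows "decidable n (\<lambda>xs. is_window d z (l xs) (F xs) (G xs) (K xs))"
  unfolding is_window_def
  by (intro decidable_intros decidable_is_vec decidable_same_cell computable_const computable_hd
      computable_tl assms)

lemma decidable_is_minimal:
  assumes "computable n G" "computable n X" "computable n B"
  shows "decidable n (\<lambda>xs. is_minimal (G xs) (X xs) (B xs))"
  unfolding is_minimal_def
  by (intro decidable_intros decidable_closed_under computable_const computable_hd
      computable_tl assms)

lemma decidable_is_recoding:
  assumes "computable n l" "computable n F" "computable n A" "computable n H" "computable n G"
    "computable n K" "computable n B" "computable n X"
  shows "decidable n (\<lambda>xs. is_recoding d z (l xs) (F xs) (A xs) (H xs) (G xs) (K xs) (B xs) (X xs))"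
  unfolding is_recoding_def
  by (intro decidable_intros decidable_is_window decidable_is_block decidable_block_step
      decidable_closed_under decidable_is_minimal computable_triple computable_const computable_hd
      computable_tl assms)

lemma set_decode_eq_iff: "set_decode a = set_decode b \<longleftrightarrow> a = b"
  by (metis set_decode_inverse)

lemma set_encode_mono:
  assumes "finite A" "C \<subseteq> A"
  shows "set_encode C \<le> set_encode A"
  unfolding set_encode_def using assms by (intro sum_mono2) auto

section \<open>Codes and the objects they stand for\<close>

context
  fixes ds :: "'d::finite list"
  assumes ds: "distinct ds" "set ds = UNIV"
begin

lemma all_coords: "(\<forall>i. P i) \<longleftrightarrow> (\<forall>i<length ds. P (ds ! i))"
  using ds(2) by (metis UNIV_I in_set_conv_nth)

lemma code_vec_eq: "code_vec ds v = code_vec ds w \<longleftrightarrow> v = w"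
proof
  assume eq: "code_vec ds v = code_vec ds w"
  have "v $ i = w $ i" for i
  proof -
    obtain m where "m < length ds" "ds ! m = i"
      using ds(2) by (metis UNIV_I in_set_conv_nth)
    then show ?thesis
      using int_nth_code_vec[of m ds v] int_nth_code_vec[of m ds w] eq by simp
  qed
  then show "v = w" by (simp add: vec_eq_iff)
qed simp

lemma is_vec_iff: "is_vec (length ds) c \<longleftrightarrow> c \<in> range (code_vec ds)"
proof
  assume c: "is_vec (length ds) c"
  define v where "v = (\<chi> i. int_nth c (SOME m. m < length ds \<and> ds ! m = i))"
  have "v $ (ds ! m) = int_nth c m" if "m < length ds" for m
  proof -
    have "(SOME m'. m' < length ds \<and> ds ! m' = ds ! m) = m"
      by (rule some_equality) (use that ds(1) in \<open>auto simp: nth_eq_iff_index_eq\<close>)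
    then show ?thesis by (simp add: v_def)
  qed
  then have "map (\<lambda>i. int_encode (v $ i)) ds = map (list_nth c) [0..<length ds]"
    by (intro nth_equalityI) (simp_all add: int_nth_def)
  then have "code_vec ds v = c"
    using c by (simp add: code_vec_def is_vec_def)
  then show "c \<in> range (code_vec ds)" by blast
next
  assume "c \<in> range (code_vec ds)"
  then obtain v where v: "c = code_vec ds v" by blast
  have "map (list_nth c) [0..<length ds] = map (\<lambda>i. int_encode (v $ i)) ds"
    by (intro nth_equalityI) (simp_all add: v code_vec_def list_nth_encode)
  then show "is_vec (length ds) c"
    by (simp add: is_vec_def v code_vec_def)
qed

lemma same_cell_iff:
  "same_cell (length ds) (code_matrix ds L) (code_vec ds g) (code_vec ds k) (code_vec ds j) (code_vec ds f)
    \<longleftrightarrow> g + k = L *v j + f"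
proof -
  have sum: "(\<Sum>m\<leftarrow>[0..<length ds]. int_nth (list_nth (code_matrix ds L) i) m * int_nth (code_vec ds j) m)
      = (L *v j) $ (ds ! i)" if "i < length ds" for i
  proof -
    have "(\<Sum>m\<leftarrow>[0..<length ds]. int_nth (list_nth (code_matrix ds L) i) m * int_nth (code_vec ds j) m)
        = (\<Sum>m\<leftarrow>[0..<length ds]. L $ (ds ! i) $ (ds ! m) * j $ (ds ! m))"
      using that
      by (intro arg_cong[where f = sum_list] map_cong)
         (auto simp: list_nth_code_matrix int_nth_code_vec)
    also have "(\<Sum>m\<leftarrow>[0..<length ds]. L $ (ds ! i) $ (ds ! m) * j $ (ds ! m))
        = (\<Sum>m\<leftarrow>map ((!) ds) [0..<length ds]. L $ (ds ! i) $ m * j $ m)"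
      by (simp add: comp_def)
    also have "\<dots> = (\<Sum>m\<in>UNIV. L $ (ds ! i) $ m * j $ m)"
      unfolding map_nth using ds by (simp add: sum_list_distinct_conv_sum_set)
    finally show ?thesis by (simp add: matrix_vector_mult_def)
  qed
  show ?thesis
    by (auto simp: same_cell_def vec_eq_iff all_coords sum int_nth_code_vec)
qed

lemma set_decode_code_domain: "finite F \<Longrightarrow> set_decode (code_domain ds F) = code_vec ds ` F"
  by (simp add: code_domain_def)

definition subst_graph :: "('a \<Rightarrow> nat) \<Rightarrow> 'a set \<Rightarrow> (int^'d) set \<Rightarrow> ('a \<Rightarrow> int^'d \<Rightarrow> 'a) \<Rightarrow> nat set" where
  "subst_graph e A F \<zeta> = (\<lambda>(a, f). triple (e a) (code_vec ds f) (e (\<zeta> a f))) ` (A \<times> F)"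

lemma code_subst_eq:
  "code_subst ds e A F \<zeta> = prod_encode (set_encode (e ` A), set_encode (subst_graph e A F \<zeta>))"
  by (simp add: code_subst_def subst_graph_def triple_def)

lemma finite_support:
  assumes "folner (supp L F)"
  shows "finite F"
  using assms unfolding folner_def by (metis supp_1)

context
  fixes A :: "'a set" and e :: "'a \<Rightarrow> nat" and L :: "int^'d^'d" and F \<zeta> G
  assumes sub: "substitution A L F \<zeta>" and prim: "primitive A L F \<zeta>"
    and G: "fundamental_domain L G" "0 \<in> G"
    and folF: "folner (supp L F)" and folG: "folner (supp L G)" and e: "inj_on e A"
begin

lemma fin: "finite A" "finite F" "finite G"
  using sub finite_support[OF folF] finite_support[OF folG] by (auto simp: substitution_def)

text \<open>\<open>e\<close> is injective only on \<open>A\<close>, so the value of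
  \<open>\<zeta>\<close> must be known to be a letter before equal codes give equal letters.\<close>

lemma in_subst_graph:
  assumes "a \<in> A" "f \<in> F" "a' \<in> A"
  shows "triple (e a) (code_vec ds f) (e a') \<in> subst_graph e A F \<zeta> \<longleftrightarrow> a' = \<zeta> a f"
proof
  assume "triple (e a) (code_vec ds f) (e a') \<in> subst_graph e A F \<zeta>"
  then obtain b h where b: "b \<in> A" "h \<in> F" "e a = e b" "f = h" "e a' = e (\<zeta> b h)"
    by (auto simp: subst_graph_def code_vec_eq)
  then have "a = b" using e assms(1) by (auto dest: inj_onD)
  moreover have "\<zeta> b h \<in> A" using sub b(1,2) by (auto simp: substitution_def)
  ultimately show "a' = \<zeta> a f" using b e assms(3) by (auto dest: inj_onD)
next
  assume "a' = \<zeta> a f"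
  then show "triple (e a) (code_vec ds f) (e a') \<in> subst_graph e A F \<zeta>"
    using assms unfolding subst_graph_def by (intro image_eqI[of _ _ "(a, f)"]) auto
qed

abbreviation "recodes \<equiv> is_recoding (length ds) (code_vec ds 0) (code_matrix ds L) (code_domain ds F)
  (set_encode (e ` A)) (set_encode (subst_graph e A F \<zeta>)) (code_domain ds G)"

text \<open>Stated for an arbitrary certificate, because the search returns the least one and not
  the one built for the existence proof. The new letters are the codes of the blocks themselves,
  numbered by \<open>id\<close>.\<close>

lemma recodes_sound:
  assumes R: "recodes K B X"
  obtains \<xi> where "prod_encode (B, X) = code_subst ds id (set_decode B) G \<xi>"
    "substitution (set_decode B) L G \<xi>" "primitive (set_decode B) L G \<xi>"
    "aperiodic A L F \<zeta> \<Longrightarrow> aperiodic (set_decode B) L G \<xi>"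
    "conjugate A (subst_shift A L F \<zeta>) (set_decode B) (subst_shift (set_decode B) L G \<xi>)"
proof -
  have finS: "finite (subst_graph e A F \<zeta>)"
    using fin by (simp add: subst_graph_def)
  note dec = set_decode_code_domain[OF fin(2)] set_decode_code_domain[OF fin(3)]
    set_encode_inverse[OF finite_imageI[OF fin(1)]] set_encode_inverse[OF finS]
  define K' where "K' = {k. code_vec ds k \<in> set_decode K}"
  define \<pi> where "\<pi> b k = (THE a. a \<in> A \<and> prod_encode (code_vec ds k, e a) \<in> set_decode b)" for b k
  define \<xi> where "\<xi> b g = (THE c. triple b (code_vec ds g) c \<in> set_decode X)" for b g
  have R': "is_window (length ds) (code_vec ds 0) (code_matrix ds L) (code_domain ds F) (code_domain ds G) K"
    "\<And>b. b \<in> set_decode B \<Longrightarrow> is_block K (set_encode (e ` A)) b"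
    "\<And>t. t \<in> set_decode X \<Longrightarrow> \<exists>b\<in>set_decode B. \<exists>g\<in>set_decode (code_domain ds G). \<exists>c\<in>set_decode B.
        t = triple b g c \<and> block_step (length ds) (code_matrix ds L) (code_domain ds F)
          (set_encode (e ` A)) (set_encode (subst_graph e A F \<zeta>)) K b g c"
    "closed_under (code_domain ds G) X B" "is_minimal (code_domain ds G) X B"
    "B = 0 \<Longrightarrow> set_encode (e ` A) = 0"
    using R unfolding is_recoding_def by blast+
  have K: "set_decode K = code_vec ds ` K'"
  proof -
    have "set_decode K \<subseteq> range (code_vec ds)"
      using R'(1) unfolding is_window_def is_vec_iff by blast
    then show ?thesis unfolding K'_def by auto
  qed
  have "finite K'"
    using finite_set_decode[of K] unfolding K
    by (rule finite_imageD) (auto simp: inj_on_def code_vec_eq)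
  have zeroK: "0 \<in> K'"
    using R'(1) by (simp add: is_window_def K'_def)
  have GK: "\<exists>j\<in>K'. \<exists>f\<in>F. g + k = L *v j + f" if "g \<in> G" "k \<in> K'" for g k
    using R'(1) that unfolding is_window_def K dec by (auto simp: same_cell_iff)
  have ex1: "\<exists>!a. a \<in> A \<and> prod_encode (code_vec ds k, e a) \<in> set_decode b"
    if b: "b \<in> set_decode B" and k: "k \<in> K'" for b k
  proof -
    obtain a where a: "a \<in> A" "prod_encode (code_vec ds k, e a) \<in> set_decode b"
      "\<forall>a'\<in>A. prod_encode (code_vec ds k, e a') \<in> set_decode b \<longrightarrow> e a' = e a"
      using R'(2)[OF b] k unfolding is_block_def K dec by blast
    show ?thesis
    proof (rule ex1I[of _ a])
      show "a \<in> A \<and> prod_encode (code_vec ds k, e a) \<in> set_decode b"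
        using a by blast
      fix a' assume "a' \<in> A \<and> prod_encode (code_vec ds k, e a') \<in> set_decode b"
      then have "e a' = e a" "a' \<in> A" using a(3) by blast+
      then show "a' = a" using a(1) by (rule inj_onD[OF e])
    qed
  qed
  have \<pi>: "\<pi> b k \<in> A" "prod_encode (code_vec ds k, e (\<pi> b k)) \<in> set_decode b"
    if "b \<in> set_decode B" "k \<in> K'" for b k
    using theI'[OF ex1[OF that], folded \<pi>_def] by blast+
  have \<pi>_eq: "\<pi> b k = a"
    if "b \<in> set_decode B" "k \<in> K'" "a \<in> A" "prod_encode (code_vec ds k, e a) \<in> set_decode b" for b k a
    using that(3,4) unfolding \<pi>_def by (intro the1_equality ex1 that conjI)
  have block: "set_decode b = (\<lambda>k. prod_encode (code_vec ds k, e (\<pi> b k))) ` K'"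
    if b: "b \<in> set_decode B" for b
  proof
    show "set_decode b \<subseteq> (\<lambda>k. prod_encode (code_vec ds k, e (\<pi> b k))) ` K'"
    proof
      fix t assume t: "t \<in> set_decode b"
      then obtain k a where ka: "k \<in> K'" "a \<in> A" "t = prod_encode (code_vec ds k, e a)"
        using R'(2)[OF b] unfolding is_block_def K dec by blast
      then have "\<pi> b k = a" using \<pi>_eq[OF b] t by blast
      then show "t \<in> (\<lambda>k. prod_encode (code_vec ds k, e (\<pi> b k))) ` K'"
        using ka by blast
    qed
  qed (use \<pi>[OF b] in blast)
  have inj: "b = c" if "b \<in> set_decode B" "c \<in> set_decode B" "\<And>k. k \<in> K' \<Longrightarrow> \<pi> b k = \<pi> c k" for b c
  proof -
    have "set_decode b = set_decode c"
      unfolding block[OF that(1)] block[OF that(2)] using that(3) by (intro image_cong) auto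
    then show ?thesis by (simp add: set_decode_eq_iff)
  qed
  have step: "b \<in> set_decode B \<and> c \<in> set_decode B \<and> g \<in> G \<and>
      (\<forall>k\<in>K'. \<forall>j\<in>K'. \<forall>f\<in>F. g + k = L *v j + f \<longrightarrow> \<pi> c k = \<zeta> (\<pi> b j) f)"
    if X: "triple b (code_vec ds g) c \<in> set_decode X" for b g c
  proof -
    have bc: "b \<in> set_decode B" "c \<in> set_decode B" "g \<in> G"
      and st: "block_step (length ds) (code_matrix ds L) (code_domain ds F)
        (set_encode (e ` A)) (set_encode (subst_graph e A F \<zeta>)) K b (code_vec ds g) c"
      using R'(3)[OF X] unfolding dec by (auto simp: code_vec_eq)
    have "\<pi> c k = \<zeta> (\<pi> b j) f" if h: "k \<in> K'" "j \<in> K'" "f \<in> F" "g + k = L *v j + f" for k j f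
    proof (rule \<pi>_eq[OF bc(2) h(1)])
      have \<pi>b: "\<pi> b j \<in> A" by (rule \<pi>[OF bc(1) h(2)])
      then show *: "\<zeta> (\<pi> b j) f \<in> A" using sub h(3) by (simp add: substitution_def)
      have "triple (e (\<pi> b j)) (code_vec ds f) (e (\<zeta> (\<pi> b j) f)) \<in> subst_graph e A F \<zeta>"
        by (simp add: in_subst_graph[OF \<pi>b h(3) *])
      moreover have "same_cell (length ds) (code_matrix ds L) (code_vec ds g) (code_vec ds k)
          (code_vec ds j) (code_vec ds f)"
        by (simp add: same_cell_iff h(4))
      ultimately show "prod_encode (code_vec ds k, e (\<zeta> (\<pi> b j) f)) \<in> set_decode c"
        using st h(1-3) \<pi>b * \<pi>(2)[OF bc(1) h(2)] unfolding block_step_def K dec by blast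
    qed
    with bc show ?thesis by blast
  qed
  have \<xi>: "triple b (code_vec ds g) c \<in> set_decode X \<longleftrightarrow> c = \<xi> b g"
    if b: "b \<in> set_decode B" and g: "g \<in> G" for b g c
  proof -
    obtain c0 where c0: "triple b (code_vec ds g) c0 \<in> set_decode X"
      using R'(4) b g unfolding closed_under_def dec by blast
    \<comment> \<open>The window property supplies \<open>j\<close> and \<open>f\<close> for each
      \<open>k\<close>, so two image blocks have the same letter at \<open>k\<close> and are equal
      by \<open>inj\<close>.\<close>
    have uniq: "c' = c0" if c': "triple b (code_vec ds g) c' \<in> set_decode X" for c'
    proof (rule inj)
      show "c' \<in> set_decode B" "c0 \<in> set_decode B" using step[OF c'] step[OF c0] by blast+
      fix k assume k: "k \<in> K'"
      then obtain j f where "j \<in> K'" "f \<in> F" "g + k = L *v j + f" using GK[OF g] by blast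
      then show "\<pi> c' k = \<pi> c0 k" using step[OF c'] step[OF c0] k by simp
    qed
    have "\<xi> b g = c0"
      unfolding \<xi>_def using c0 uniq by (rule the_equality)
    then show ?thesis using c0 uniq by blast
  qed
  have \<xi>X: "triple b (code_vec ds g) (\<xi> b g) \<in> set_decode X" if "b \<in> set_decode B" "g \<in> G" for b g
    using \<xi>[OF that] by simp
  have sub': "substitution (set_decode B) L G \<xi>"
    using sub G \<xi>X step unfolding substitution_def by (simp add: finite_set_decode) blast
  have X: "set_decode X = (\<lambda>(b, g). triple b (code_vec ds g) (\<xi> b g)) ` (set_decode B \<times> G)"
  proof
    show "set_decode X \<subseteq> (\<lambda>(b, g). triple b (code_vec ds g) (\<xi> b g)) ` (set_decode B \<times> G)"
    proof
      fix t assume t: "t \<in> set_decode X"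
      then obtain b g c where *: "b \<in> set_decode B" "g \<in> G" "t = triple b (code_vec ds g) c"
        using R'(3)[OF t] unfolding dec by blast
      then have "c = \<xi> b g" using \<xi>[OF *(1,2)] t by blast
      with * show "t \<in> (\<lambda>(b, g). triple b (code_vec ds g) (\<xi> b g)) ` (set_decode B \<times> G)"
        by (intro image_eqI[of _ _ "(b, g)"]) auto
    qed
  qed (use \<xi>X in auto)
  interpret block_recoding A L F \<zeta> G K' "set_decode B" \<xi> \<pi>
  proof
    show "substitution A L F \<zeta>" "primitive A L F \<zeta>" "folner (supp L F)" "folner (supp L G)"
      by (rule sub prim folF folG)+
    show "substitution (set_decode B) L G \<xi>" by (rule sub')
    show "finite K'" "0 \<in> K'" by fact+
    show "\<exists>j\<in>K'. \<exists>f\<in>F. g + k = L *v j + f" if "g \<in> G" "k \<in> K'" for g k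
      using that by (rule GK)
    show "\<pi> b k \<in> A" if "b \<in> set_decode B" "k \<in> K'" for b k
      using that by (rule \<pi>)
    show "b = c" if "b \<in> set_decode B" "c \<in> set_decode B" "\<And>k. k \<in> K' \<Longrightarrow> \<pi> b k = \<pi> c k" for b c
      using that by (rule inj)
    show "\<pi> (\<xi> b g) k = \<zeta> (\<pi> b j) f" if "b \<in> set_decode B" "g \<in> G" "k \<in> K'" "j \<in> K'" "f \<in> F"
      "g + k = L *v j + f" for b g k j f
      using step[OF \<xi>X[OF that(1,2)]] that(3-) by blast
    show "C = set_decode B" if C: "C \<subseteq> set_decode B" "C \<noteq> {}"
      "\<And>b g. b \<in> C \<Longrightarrow> g \<in> G \<Longrightarrow> \<xi> b g \<in> C" for C
    proof -
      have finC: "finite C" using C(1) finite_subset finite_set_decode by blast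
      \<comment> \<open>The subset is coded so that it falls under the bounded quantifier of
        \<open>is_minimal\<close>.\<close>
      have "set_encode C \<le> set_encode (set_decode B)"
        by (rule set_encode_mono[OF finite_set_decode C(1)])
      moreover have "set_encode C \<noteq> 0"
        using C(2) finC by (metis set_encode_inverse set_decode_zero)
      moreover have "closed_under (code_domain ds G) X (set_encode C)"
        unfolding closed_under_def dec set_encode_inverse[OF finC]
        using C(1,3) \<xi>X by blast
      moreover have "\<forall>c\<in>set_decode (set_encode C). c \<in> set_decode B"
        unfolding set_encode_inverse[OF finC] using C(1) by blast
      moreover have "D = B" if "D \<le> B" "\<forall>c\<in>set_decode D. c \<in> set_decode B" "D \<noteq> 0"
        "closed_under (code_domain ds G) X D" for D
        using R'(5) that unfolding is_minimal_def by blast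
      ultimately have "set_encode C = B"
        by (simp only: set_decode_inverse)
      then show ?thesis using set_encode_inverse[OF finC] by simp
    qed
    show "set_decode B \<noteq> {}" if "A \<noteq> {}"
    proof
      assume "set_decode B = {}"
      then have "B = 0" using set_decode_inverse[of B] by simp
      then have "set_encode (e ` A) = 0" by (rule R'(6))
      then have "set_decode (set_encode (e ` A)) = {}" by (simp only: set_decode_zero)
      then have "e ` A = {}" by (simp only: dec(3))
      with that show False by simp
    qed
  qed
  show thesis
  proof (rule that)
    have "subst_graph id (set_decode B) G \<xi> = set_decode X"
      by (simp add: subst_graph_def X)
    then show "prod_encode (B, X) = code_subst ds id (set_decode B) G \<xi>"
      by (simp add: code_subst_eq)
    show "conjugate A (subst_shift A L F \<zeta>) (set_decode B) (subst_shift (set_decode B) L G \<xi>)"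
      by (rule conjugate_recoding)
  qed (use sub' primitive_recoding aperiodic_recoding in auto)
qed

text \<open>The set of all blocks of shape \<open>K'\<close> over \<open>A\<close> is finite and
  closed under taking image blocks. A minimal member of the family of its closed subsets, nonempty
  unless \<open>A\<close> is empty, passes every check.\<close>

lemma ex_recodes: "\<exists>K B X. recodes K B X"
proof -
  have finS: "finite (subst_graph e A F \<zeta>)"
    using fin by (simp add: subst_graph_def)
  obtain K' where K': "finite K'" "0 \<in> K'" "\<And>g k. g \<in> G \<Longrightarrow> k \<in> K' \<Longrightarrow> \<exists>j\<in>K'. \<exists>f\<in>F. g + k = L *v j + f"
    using ex_window[of L F G] sub fin unfolding substitution_def by blast
  define K where "K = set_encode (code_vec ds ` K')"
  have K: "set_decode K = code_vec ds ` K'"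
    using K'(1) by (simp add: K_def)
  note dec = set_decode_code_domain[OF fin(2)] set_decode_code_domain[OF fin(3)]
    set_encode_inverse[OF finite_imageI[OF fin(1)]] set_encode_inverse[OF finS]
  define enc where "enc w = set_encode ((\<lambda>k. prod_encode (code_vec ds k, e (w k))) ` K')" for w
  have enc: "set_decode (enc w) = (\<lambda>k. prod_encode (code_vec ds k, e (w k))) ` K'" for w
    using K'(1) by (simp add: enc_def)
  have in_enc: "prod_encode (code_vec ds k, n) \<in> set_decode (enc w) \<longleftrightarrow> n = e (w k)" if "k \<in> K'" for k n w
    using that by (auto simp: enc code_vec_eq)
  let ?step = "block_step (length ds) (code_matrix ds L) (code_domain ds F)
    (set_encode (e ` A)) (set_encode (subst_graph e A F \<zeta>)) K"
  define Bl where "Bl = enc ` (K' \<rightarrow>\<^sub>E A)"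
  have finBl: "finite Bl"
    unfolding Bl_def using K'(1) fin(1) by (intro finite_imageI finite_PiE) auto
  have window: "is_window (length ds) (code_vec ds 0) (code_matrix ds L) (code_domain ds F) (code_domain ds G) K"
    unfolding is_window_def K dec is_vec_iff using K'(2,3) by (auto simp: same_cell_iff)
  have block: "is_block K (set_encode (e ` A)) b" if "b \<in> Bl" for b
  proof -
    obtain w where w: "b = enc w" "\<And>k. k \<in> K' \<Longrightarrow> w k \<in> A"
      using \<open>b \<in> Bl\<close> unfolding Bl_def by (auto simp: PiE_def Pi_def)
    show ?thesis
      unfolding is_block_def K dec w(1) using w(2) by (auto simp: in_enc) (auto simp: enc)
  qed
  have step: "\<exists>c\<in>Bl. ?step b (code_vec ds g) c" if "b \<in> Bl" "g \<in> G" for b g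
  proof -
    obtain w where w: "b = enc w" "\<And>k. k \<in> K' \<Longrightarrow> w k \<in> A"
      using \<open>b \<in> Bl\<close> unfolding Bl_def by (auto simp: PiE_def Pi_def)
    \<comment> \<open>As \<open>K'\<close> is a window, \<open>decomp\<close> of
      \<open>g + k\<close> has its first component in \<open>K'\<close>, where \<open>w\<close>
      takes values in \<open>A\<close>. The restriction to \<open>K'\<close> makes \<open>w'\<close>
      extensional, as membership in the finite set of blocks requires.\<close>
    define w' where "w' = (\<lambda>k\<in>K'. case decomp L F (g + k) of (j, f) \<Rightarrow> \<zeta> (w j) f)"
    have w': "w' k = \<zeta> (w j) f" if "k \<in> K'" "f \<in> F" "g + k = L *v j + f" for k j f
      using that decomp_eq[OF sub that(2), of j] by (simp add: w'_def)
    have "w' \<in> K' \<rightarrow>\<^sub>E A"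
    proof (rule PiE_I)
      fix k assume k: "k \<in> K'"
      then obtain j f where jf: "j \<in> K'" "f \<in> F" "g + k = L *v j + f"
        using K'(3)[OF \<open>g \<in> G\<close>] by blast
      then show "w' k \<in> A"
        using w'[OF k jf(2,3)] w(2)[OF jf(1)] sub by (simp add: substitution_def)
    qed (simp add: w'_def)
    then have "enc w' \<in> Bl" by (simp add: Bl_def)
    moreover have "?step b (code_vec ds g) (enc w')"
      unfolding block_step_def K dec
    proof (intro ballI impI, elim imageE conjE, hypsubst)
      fix k j f a a' assume h: "k \<in> K'" "j \<in> K'" "f \<in> F" "a \<in> A" "a' \<in> A"
        and cell: "same_cell (length ds) (code_matrix ds L) (code_vec ds g) (code_vec ds k) (code_vec ds j) (code_vec ds f)"
        and b: "prod_encode (code_vec ds j, e a) \<in> set_decode b"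
        and t: "triple (e a) (code_vec ds f) (e a') \<in> subst_graph e A F \<zeta>"
      have "a = w j"
        using b w(2)[OF h(2)] h(2,4) e by (auto simp: w(1) in_enc dest: inj_onD)
      moreover have "a' = \<zeta> a f"
        using t in_subst_graph[OF h(4,3,5)] by simp
      ultimately show "prod_encode (code_vec ds k, e a') \<in> set_decode (enc w')"
        using cell by (simp add: in_enc h w'[OF h(1,3)] same_cell_iff)
    qed
    ultimately show ?thesis by blast
  qed
  then obtain \<sigma> where \<sigma>: "\<And>b g. b \<in> Bl \<Longrightarrow> g \<in> G \<Longrightarrow> \<sigma> b g \<in> Bl \<and> ?step b (code_vec ds g) (\<sigma> b g)"
    by metis
  \<comment> \<open>The implication admits the empty set only over an empty alphabet, where there
    are no blocks because \<open>K'\<close> is nonempty.\<close>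
  define \<C> where "\<C> = {C. C \<subseteq> Bl \<and> (C = {} \<longrightarrow> A = {}) \<and> (\<forall>b\<in>C. \<forall>g\<in>G. \<sigma> b g \<in> C)}"
  have "Bl \<in> \<C>"
  proof -
    have "A = {}" if "Bl = {}"
      using that K'(2) unfolding Bl_def by (auto simp: PiE_eq_empty_iff)
    then show ?thesis using \<sigma> by (auto simp: \<C>_def)
  qed
  moreover have "finite \<C>"
    by (rule finite_subset[of _ "Pow Bl"]) (auto simp: \<C>_def finBl)
  ultimately obtain C where C: "C \<in> \<C>" "\<And>C'. C' \<in> \<C> \<Longrightarrow> C' \<subseteq> C \<Longrightarrow> C' = C"
    using finite_has_minimal[of \<C>] by blast
  have CBl: "C \<subseteq> Bl" and finC: "finite C"
    using C(1) finBl by (auto simp: \<C>_def dest: finite_subset)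
  define T where "T = (\<lambda>(b, g). triple b (code_vec ds g) (\<sigma> b g)) ` (C \<times> G)"
  have finT: "finite T" using finC fin by (simp add: T_def)
  note decC = set_encode_inverse[OF finC] set_encode_inverse[OF finT]
  have in_T: "triple b (code_vec ds g) c \<in> T \<longleftrightarrow> b \<in> C \<and> g \<in> G \<and> c = \<sigma> b g" for b g c
    by (force simp: T_def code_vec_eq)
  have "recodes K (set_encode C) (set_encode T)"
    unfolding is_recoding_def
  proof (intro conjI)
    show "\<forall>b\<in>set_decode (set_encode C). is_block K (set_encode (e ` A)) b"
      unfolding decC using block CBl by blast
    have CC: "\<sigma> b g \<in> C" if "b \<in> C" "g \<in> G" for b g
      using C(1) that by (auto simp: \<C>_def)
    show "\<forall>t\<in>set_decode (set_encode T). \<exists>b\<in>set_decode (set_encode C).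
        \<exists>g\<in>set_decode (code_domain ds G). \<exists>c\<in>set_decode (set_encode C). t = triple b g c \<and> ?step b g c"
      unfolding decC dec
    proof
      fix t assume "t \<in> T"
      then obtain b g where bg: "b \<in> C" "g \<in> G" "t = triple b (code_vec ds g) (\<sigma> b g)"
        by (auto simp: T_def)
      with CC \<sigma> CBl show "\<exists>b\<in>C. \<exists>g\<in>code_vec ds ` G. \<exists>c\<in>C. t = triple b g c \<and> ?step b g c"
        by blast
    qed
    show "closed_under (code_domain ds G) (set_encode T) (set_encode C)"
      unfolding closed_under_def decC dec using CC by (auto simp: in_T)
    show "is_minimal (code_domain ds G) (set_encode T) (set_encode C)"
      unfolding is_minimal_def
    proof (intro allI impI)
      fix D assume D: "(\<forall>c\<in>set_decode D. c \<in> set_decode (set_encode C)) \<and> D \<noteq> 0 \<and>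
          closed_under (code_domain ds G) (set_encode T) D"
      then have DC: "set_decode D \<subseteq> C" by (auto simp: decC)
      have "set_decode D \<noteq> {}" using D by (metis set_decode_inverse set_encode_empty)
      moreover have "\<sigma> b g \<in> set_decode D" if "b \<in> set_decode D" "g \<in> G" for b g
        using D that unfolding closed_under_def decC dec by (force simp: in_T)
      ultimately have "set_decode D \<in> \<C>" using DC CBl by (auto simp: \<C>_def)
      then have "set_decode D = C" using C(2) DC by blast
      then show "D = set_encode C" by (metis set_decode_inverse)
    qed
    show "set_encode C = 0 \<longrightarrow> set_encode (e ` A) = 0"
    proof
      assume "set_encode C = 0"
      then have "C = {}" using decC(1) by simp
      then have "A = {}" using C(1) by (simp add: \<C>_def)
      then show "set_encode (e ` A) = 0" by simp
    qed
  qed (rule window)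
  then show ?thesis by blast
qed

end

end

text \<open>Fixing \<open>ds\<close> fixes the dimension, and one program then serves all
  substitutions: it finds the least coded certificate and outputs the alphabet and graph in it,
  which together are literally the code of the new substitution.\<close>

theorem theorem4p1:
  fixes ds :: "'d::finite list"
  assumes "distinct ds" and "set ds = UNIV"
  shows "\<exists>p. \<forall>(A :: 'a set) (e :: 'a \<Rightarrow> nat) (L :: int^'d^'d) F \<zeta> G.
           substitution A L F \<zeta> \<and> primitive A L F \<zeta> \<and> aperiodic A L F \<zeta> \<and>
           fundamental_domain L G \<and> 0 \<in> G \<and>
           folner (supp L F) \<and> folner (supp L G) \<and>
           inj_on e A \<longrightarrow>
           (\<exists>(B :: nat set) \<xi>.
              evaluates p
                [code_matrix ds L, code_domain ds F, code_subst ds e A F \<zeta>, code_domain ds G]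
                (code_subst ds id B G \<xi>) \<and>
              substitution B L G \<xi> \<and> primitive B L G \<xi> \<and> aperiodic B L G \<xi> \<and>
              conjugate A (subst_shift A L F \<zeta>) B (subst_shift B L G \<xi>))"
proof -
  \<comment> \<open>A certificate is the single number
    \<open>prod_encode (K, prod_encode (B, X))\<close>, so one minimisation finds all three parts
    and dropping the first component leaves the output.\<close>
  define R where "R m xs \<longleftrightarrow> is_recoding (length ds) (code_vec ds 0) (xs ! 0) (xs ! 1)
      (fst (prod_decode (xs ! 2))) (snd (prod_decode (xs ! 2))) (xs ! 3)
      (fst (prod_decode m)) (fst (prod_decode (snd (prod_decode m))))
      (snd (prod_decode (snd (prod_decode m))))" for m and xs :: "nat list"
  have "decidable (Suc 4) (\<lambda>xs. R (hd xs) (tl xs))"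
    unfolding R_def
    by (intro decidable_is_recoding computable_fst_prod_decode computable_snd_prod_decode
        computable_hd computable_tl computable_nth) simp_all
  then obtain q where q: "\<And>xs. length xs = 4 \<Longrightarrow> \<exists>m. R m xs \<Longrightarrow> evaluates q xs (LEAST m. R m xs)"
    by (rule computable_search) blast
  have "computable 1 (\<lambda>xs. snd (prod_decode (xs ! 0)))"
    by (intro computable_snd_prod_decode computable_nth) simp
  then obtain r where "\<And>xs. length xs = 1 \<Longrightarrow> evaluates r xs (snd (prod_decode (xs ! 0)))"
    unfolding computable_def by blast
  then have r: "evaluates r [m] (snd (prod_decode m))" for m
    by (metis One_nat_def length_Cons list.size(3) nth_Cons_0)
  show ?thesis
  proof (intro exI[of _ "Cn r [q]"] allI impI, elim conjE)
    fix A :: "'a set" and e :: "'a \<Rightarrow> nat" and L :: "int^'d^'d" and F \<zeta> G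
    assume h: "substitution A L F \<zeta>" "primitive A L F \<zeta>" "fundamental_domain L G" "0 \<in> G"
      "folner (supp L F)" "folner (supp L G)" "inj_on e A" and ap: "aperiodic A L F \<zeta>"
    let ?xs = "[code_matrix ds L, code_domain ds F, code_subst ds e A F \<zeta>, code_domain ds G]"
    let ?R = "is_recoding (length ds) (code_vec ds 0) (code_matrix ds L) (code_domain ds F)
      (set_encode (e ` A)) (set_encode (subst_graph ds e A F \<zeta>)) (code_domain ds G)"
    have R: "R m ?xs \<longleftrightarrow> ?R (fst (prod_decode m)) (fst (prod_decode (snd (prod_decode m))))
        (snd (prod_decode (snd (prod_decode m))))" for m
      by (simp add: R_def code_subst_eq[OF assms])
    obtain K B X where "?R K B X"
      using ex_recodes[OF assms h] by blast
    then have ex: "\<exists>m. R m ?xs"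
      by (intro exI[of _ "prod_encode (K, prod_encode (B, X))"]) (simp add: R)
    define m where "m = (LEAST m. R m ?xs)"
    have "evaluates q ?xs m"
      unfolding m_def by (rule q[OF _ ex]) simp
    then have ev: "evaluates (Cn r [q]) ?xs (snd (prod_decode m))"
      by (intro evaluates.Cn[of _ _ "[m]"] r) simp
    have "R m ?xs"
      unfolding m_def by (rule LeastI_ex[OF ex])
    then have "?R (fst (prod_decode m)) (fst (prod_decode (snd (prod_decode m))))
        (snd (prod_decode (snd (prod_decode m))))"
      by (simp only: R)
    from recodes_sound[OF assms h this]
    show "\<exists>(B :: nat set) \<xi>. evaluates (Cn r [q]) ?xs (code_subst ds id B G \<xi>) \<and>
        substitution B L G \<xi> \<and> primitive B L G \<xi> \<and> aperiodic B L G \<xi> \<and>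
        conjugate A (subst_shift A L F \<zeta>) B (subst_shift B L G \<xi>)"
      using ev ap by (metis prod.collapse prod_decode_inverse)
  qed
qed

end
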